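(* Let $(\Omega,\mu,d)$ be a metric measure space satisfying the standing assumptions, let $w$ be an isoperimetric weight on $\Omega$, let $p>1$ and let $\alpha>0$. Then there is a constant $D=D(w,p)$ (depending on $w$ and $p$, for the given space) such that the following holds. If $\mu(\Omega)<\infty$, then for every $f\in Lip(\Omega)$ such that $m(f)=0$ (that is, $0$ is a median of $f$) or $\int_\Omega f\,d\mu=0$, $$\|f\|_{p}\le D\,r\,\big\||\nabla f|\big\|_{p}+2r^{-\alpha}\big\|w^{\alpha}|f|\big\|_{p}\quad\text{for all } r>0 .$$ If $\mu(\Omega)=\infty$, then the same inequality holds for every $f\in Lip_0(\Omega)$ and all $r>0$. Here $\|\cdot\|_p$ is the norm of $L^p(\Omega,\mu)$.
   Context: Setting and standing assumptions. $(\Omega,\mu,d)$ is a connected metric space with a Borel measure $\mu$ such that $\mu(K)<\infty$ for every compact $K\subset\Omega$. $Lip(\Omega)$ is the set of real-valued Lipschitz functions on $\Omega$ and $Lip_0(\Omega)$ the set of those with compact support. For $f\in Lip(\Omega)$, $|\nabla f(x)|=\limsup_{d(x,y)\to0}\frac{|f(x)-f(y)|}{d(x,y)}$. For a Borel set $A\subset\Omega$, $\mu^+(A)=\liminf_{h\to0}\frac{\mu(A_h)-\mu(A)}{h}$, where $A_h=\{x\in\Omega:d(x,A)<h\}$. The isoperimetric profile is $I:[0,\mu(\Omega))\to\mathbb{R}_+$, $I(t)=\inf\{\mu^+(A):\mu(A)=t\}$. It is assumed throughout that $I$ is concave, continuous and $I(0)=0$; when $\mu(\Omega)<\infty$ it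 is also assumed that $I$ is symmetric around $\mu(\Omega)/2$ (so $I$ is increasing on $(0,\mu(\Omega)/2)$ and decreasing on $(\mu(\Omega)/2,\mu(\Omega))$); when $\mu(\Omega)=\infty$ it is assumed that $I$ is increasing. It is understood that $I>0$ on $(0,\mu(\Omega))$; the (non-decreasing) quotient $t/I(t)$ is read as $0$ at $t=0$ and as its limit at $t=\infty$. Median (when $\mu(\Omega)<\infty$). A real number $m(f)$ is a median of an integrable $f$ if $\mu\{f\ge m(f)\}\ge\mu(\Omega)/2$ and $\mu\{f\le m(f)\}\ge\mu(\Omega)/2$. Isoperimetric weight. A locally integrable $w:\Omega\to\mathbb{R}_+$ with $w>0$ a.e. is an isoperimetric weight if there is a constant $C=C(w)>0$ such that $$\frac{\min\{\mu(\{w\le r\}),\mu(\Omega)/2\}}{I(\min\{\mu(\{w\le r\}),\mu(\Omega)/2\})}\le Cr\quad\text{for all } r>0 .$$ When $\mu(\Omega)=\infty$ the minimum is simply $\mu(\{w\le r\})$. *)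

theory Defs
  imports "HOL-Analysis.Analysis"
begin

definition Lip :: "('a::metric_space \<Rightarrow> real) set" where
  "Lip = {f. \<exists>L. L-lipschitz_on UNIV f}"

definition Lip0 :: "('a::metric_space \<Rightarrow> real) set" where
  "Lip0 = {f \<in> Lip. compact (closure {x. f x \<noteq> 0})}"

text \<open>The limsup is taken in the extended nonnegative reals; for Lipschitz functions it is finite.
  At an isolated point the value is 0.\<close>

definition grad_norm :: "('a::metric_space \<Rightarrow> real) \<Rightarrow> 'a \<Rightarrow> real" where
  "grad_norm f x = enn2real (Limsup (at x) (\<lambda>y. ennreal (\<bar>f x - f y\<bar> / dist x y)))"

text \<open>The nonemptiness condition expresses the convention that the distance to the empty set is
  infinite (whereas infdist to the empty set is 0).\<close>

definition enlargement :: "'a::metric_space set \<Rightarrow> real \<Rightarrow> 'a set" where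
  "enlargement A h = {x. A \<noteq> {} \<and> infdist x A < h}"

definition minkowski_content :: "'a::metric_space measure \<Rightarrow> 'a set \<Rightarrow> ennreal" where
  "minkowski_content M A =
     Liminf (at_right 0) (\<lambda>h::real. (emeasure M (enlargement A h) - emeasure M A) / ennreal h)"

definition iso_profile :: "'a::metric_space measure \<Rightarrow> ennreal \<Rightarrow> ennreal" where
  "iso_profile M t = (INF A\<in>{A \<in> sets borel. emeasure M A = t}. minkowski_content M A)"

text \<open>The profile is a priori an infimum in the extended nonnegative reals, with value \<open>\<infinity>\<close> for an
  empty infimum; the assumption \<open>profile_finite\<close> says that it is real-valued on
  \<open>[0, \<mu>(\<Omega>))\<close>.  Symmetry is stated where both t and \<open>\<mu>(\<Omega>) - t\<close> lie in the domain; the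
  monotonicity on the two halves follows from it and concavity.\<close>

locale isoperimetric_space =
  fixes M :: "'a::metric_space measure"
  assumes connected_space: "connected (UNIV :: 'a set)"
    and sets_borel: "sets M = sets borel"
    and compact_finite: "\<And>K. compact K \<Longrightarrow> emeasure M K < \<infinity>"
    and profile_finite: "\<And>t. t < emeasure M (space M) \<Longrightarrow> iso_profile M t < \<infinity>"
    and profile_pos: "\<And>t. 0 < t \<Longrightarrow> t < emeasure M (space M) \<Longrightarrow> 0 < iso_profile M t"
    and profile_zero: "iso_profile M 0 = 0"
    and profile_concave:
      "concave_on {t::real. 0 \<le> t \<and> ennreal t < emeasure M (space M)}
         (\<lambda>t. enn2real (iso_profile M (ennreal t)))"
    and profile_continuous:
      "continuous_on {t::real. 0 \<le> t \<and> ennreal t < emeasure M (space M)}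
         (\<lambda>t. enn2real (iso_profile M (ennreal t)))"
    and profile_symmetric:
      "\<And>t. emeasure M (space M) < \<infinity> \<Longrightarrow> 0 < t \<Longrightarrow> t < emeasure M (space M) \<Longrightarrow>
         iso_profile M (emeasure M (space M) - t) = iso_profile M t"
    and profile_increasing:
      "emeasure M (space M) = \<infinity> \<Longrightarrow> mono_on {..<\<infinity>} (iso_profile M)"

definition iso_quotient :: "'a::metric_space measure \<Rightarrow> ennreal \<Rightarrow> ennreal" where
  "iso_quotient M t =
     (if t = 0 then 0
      else if t = \<infinity> then Lim at_top (\<lambda>s::real. ennreal s / iso_profile M (ennreal s))
      else t / iso_profile M t)"

text \<open>Local integrability means integrability on compact sets.  If \<open>\<mu>(\<Omega>) = \<infinity>\<close>, then
  \<open>\<mu>(\<Omega>)/2 = \<infinity>\<close> and the minimum below is just \<open>\<mu>{w \<le> r}\<close>.\<close>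

definition isoperimetric_weight :: "'a::metric_space measure \<Rightarrow> ('a \<Rightarrow> real) \<Rightarrow> bool" where
  "isoperimetric_weight M w \<longleftrightarrow>
     (\<forall>x. 0 \<le> w x) \<and> w \<in> borel_measurable M \<and>
     (\<forall>K. compact K \<longrightarrow> set_integrable M K w) \<and>
     (AE x in M. 0 < w x) \<and>
     (\<exists>C>0. \<forall>r>0.
        iso_quotient M (min (emeasure M {x \<in> space M. w x \<le> r}) (emeasure M (space M) / 2))
          \<le> ennreal (C * r))"

definition is_median :: "'a measure \<Rightarrow> ('a \<Rightarrow> real) \<Rightarrow> real \<Rightarrow> bool" where
  "is_median M f m \<longleftrightarrow> integrable M f \<and>
     emeasure M {x \<in> space M. f x \<ge> m} \<ge> emeasure M (space M) / 2 \<and>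
     emeasure M {x \<in> space M. f x \<le> m} \<ge> emeasure M (space M) / 2"

definition Lp_norm :: "'a measure \<Rightarrow> real \<Rightarrow> ('a \<Rightarrow> real) \<Rightarrow> ennreal" where
  "Lp_norm M p f =
     (let J = (\<integral>\<^sup>+ x. ennreal (\<bar>f x\<bar> powr p) \<partial>M)
      in if J = \<infinity> then \<infinity> else ennreal (enn2real J powr (1 / p)))"

end

theory Submission
  imports Defs
begin

text \<open>
  The coarea inequality bounds \<open>\<integral> I(\<mu>{u > t}) dt\<close> by \<open>\<integral> |\<nabla>u| d\<mu>\<close>.  Since \<open>I\<close> is increasing and \<open>t / I(t)\<close>
  non-decreasing on \<open>(0, \<mu>(\<Omega>)/2]\<close>, one has \<open>\<mu>(A \<inter> {u > t}) \<le> Q(A) I(\<mu>{u > t})\<close> whenever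
  \<open>\<mu>{u > 0} \<le> \<mu>(\<Omega>)/2\<close>, where \<open>Q(A)\<close> is the quotient at \<open>min {\<mu>(A), \<mu>(\<Omega>)/2}\<close>; hence
  \<open>\<integral>\<^sub>A u \<le> Q(A) \<integral> |\<nabla>u|\<close>.  With \<open>u = (f\<^sup>\<plusminus>)\<^sup>p\<close> and Young's inequality this gives
  \<open>\<integral>\<^sub>A |f|\<^sup>p \<le> \<delta> \<integral> |f|\<^sup>p + c Q(A)\<^sup>p \<integral> |\<nabla>f|\<^sup>p\<close> for \<open>f\<close> with median 0.  Take \<open>A = {w \<le> r}\<close>, where \<open>Q(A) \<le> C r\<close>,
  bound \<open>|f|\<close> by \<open>r\<^sup>-\<^sup>\<alpha> w\<^sup>\<alpha> |f|\<close> off \<open>A\<close>, and absorb the term with \<open>\<delta>\<close> into the left-hand side.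

  If instead \<open>f\<close> has mean 0 and median \<open>m\<close>, then for \<open>r\<close> bounded below the Poincare inequality for \<open>f - m\<close>
  suffices, and for small \<open>r\<close> the set \<open>A\<close> has small measure (because \<open>w > 0\<close> almost everywhere), so that
  \<open>|m|\<^sup>p \<mu>(A)\<close> is a small multiple of \<open>\<integral> |f|\<^sup>p\<close> and can be absorbed as well.
\<close>

section \<open>Slopes of Lipschitz functions\<close>

text \<open>A Lipschitz constant at scale \<open>h\<close>, taken in the extended reals so that the
  supremum over an empty punctured ball is 0. It shrinks with \<open>h\<close>, and its limit as
  \<open>h\<close> tends to 0 is the limsup behind \<open>grad_norm\<close>.\<close>

definition slope :: "('a::metric_space \<Rightarrow> real) \<Rightarrow> real \<Rightarrow> 'a \<Rightarrow> ennreal" where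
  "slope f h x = (SUP y\<in>{y. y \<noteq> x \<and> dist y x < h}. ennreal (\<bar>f x - f y\<bar> / dist x y))"

lemma quotient_le_lipschitz:
  assumes "L-lipschitz_on UNIV f"
  shows "ennreal (\<bar>f x - f y\<bar> / dist x y) \<le> ennreal L"
proof -
  have "\<bar>f x - f y\<bar> \<le> L * dist x y" "0 \<le> L"
    using lipschitz_onD[OF assms] lipschitz_on_nonneg[OF assms] by (auto simp: dist_real_def)
  then show ?thesis
    by (cases "x = y") (auto simp: divide_le_eq intro!: ennreal_leI)
qed

lemma slope_le_lipschitz:
  assumes "L-lipschitz_on UNIV f"
  shows "slope f h x \<le> ennreal L"
  unfolding slope_def by (intro SUP_least quotient_le_lipschitz[OF assms])

lemma le_slope:
  assumes "dist x y < h"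
  shows "ennreal \<bar>f x - f y\<bar> \<le> ennreal h * slope f h x"
proof (cases "x = y")
  case False
  have "ennreal \<bar>f x - f y\<bar> = ennreal (dist x y) * ennreal (\<bar>f x - f y\<bar> / dist x y)"
    using False by (simp flip: ennreal_mult)
  also have "\<dots> \<le> ennreal h * slope f h x"
    unfolding slope_def using assms False
    by (intro mult_mono ennreal_leI SUP_upper) (auto simp: dist_commute)
  finally show ?thesis .
qed auto

lemma slope_mono: "h \<le> k \<Longrightarrow> slope f h x \<le> slope f k x"
  unfolding slope_def by (intro SUP_subset_mono) auto

text \<open>Punctured balls form a basis of the filter \<open>at x\<close>, and radii tending to 0
  eventually fit into each of them. A countable family of radii is what makes
  \<open>grad_norm\<close> measurable and allows monotone convergence for the integrals of
  slopes.\<close>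

lemma Limsup_quotient_eq_INF_slope:
  assumes "\<And>n. 0 < h n" "h \<longlonglongrightarrow> 0"
  shows "Limsup (at x) (\<lambda>y. ennreal (\<bar>f x - f y\<bar> / dist x y)) = (INF n. slope f (h n) x)"
proof (rule antisym)
  show "Limsup (at x) (\<lambda>y. ennreal (\<bar>f x - f y\<bar> / dist x y)) \<le> (INF n. slope f (h n) x)"
    unfolding Limsup_def slope_def
  proof (rule INF_greatest)
    fix n
    have "eventually (\<lambda>y. y \<noteq> x \<and> dist y x < h n) (at x)"
      using assms(1)[of n] by (auto simp: eventually_at)
    then show "(INF P\<in>{P. eventually P (at x)}. SUP y\<in>{y. P y}. ennreal (\<bar>f x - f y\<bar> / dist x y))
      \<le> (SUP y\<in>{y. y \<noteq> x \<and> dist y x < h n}. ennreal (\<bar>f x - f y\<bar> / dist x y))"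
      by (intro INF_lower2[of "\<lambda>y. y \<noteq> x \<and> dist y x < h n"]) auto
  qed
  show "(INF n. slope f (h n) x) \<le> Limsup (at x) (\<lambda>y. ennreal (\<bar>f x - f y\<bar> / dist x y))"
    unfolding Limsup_def
  proof (rule INF_greatest)
    fix P assume "P \<in> {P. eventually P (at x)}"
    then obtain d where d: "d > 0" "\<And>y. y \<noteq> x \<Longrightarrow> dist y x < d \<Longrightarrow> P y"
      by (auto simp: eventually_at)
    obtain n where "h n < d"
      using order_tendstoD(2)[OF assms(2) d(1)] by (auto simp: eventually_sequentially)
    then show "(INF n. slope f (h n) x) \<le> (SUP y\<in>{y. P y}. ennreal (\<bar>f x - f y\<bar> / dist x y))"
      unfolding slope_def using d by (intro INF_lower2[of n] SUP_subset_mono) auto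
  qed
qed

lemma ennreal_grad_norm:
  assumes "f \<in> Lip"
  shows "ennreal (grad_norm f x) = Limsup (at x) (\<lambda>y. ennreal (\<bar>f x - f y\<bar> / dist x y))"
proof -
  obtain L where L: "L-lipschitz_on UNIV f" using assms by (auto simp: Lip_def)
  have "Limsup (at x) (\<lambda>y. ennreal (\<bar>f x - f y\<bar> / dist x y)) \<le> ennreal L"
    by (intro Limsup_bounded always_eventually allI quotient_le_lipschitz[OF L])
  then show ?thesis
    unfolding grad_norm_def by (intro ennreal_enn2real) (auto simp: less_top[symmetric] top_unique)
qed

lemma grad_norm_nonneg: "0 \<le> grad_norm f x"
  by (simp add: grad_norm_def)

lemma Lip_continuous: "f \<in> Lip \<Longrightarrow> continuous_on UNIV f"
  by (auto simp: Lip_def intro: lipschitz_on_continuous_on)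

lemma Lip_measurable: "f \<in> Lip \<Longrightarrow> f \<in> borel_measurable borel"
  by (intro borel_measurable_continuous_onI Lip_continuous)

text \<open>Lower semicontinuity: for fixed \<open>y\<close> the quotient is continuous off
  \<open>y\<close>, so a strict superlevel set of the supremum is a union of open sets, even though
  the supremum is uncountable.\<close>

lemma slope_measurable:
  fixes f :: "'a::metric_space \<Rightarrow> real"
  assumes "f \<in> Lip"
  shows "slope f h \<in> borel_measurable borel"
proof (rule borel_measurableI_greater)
  fix c :: ennreal
  have f: "continuous_on UNIV f" using assms by (rule Lip_continuous)
  have "{x. c < slope f h x} =
    (\<Union>y. {x. y \<noteq> x \<and> dist y x < h \<and> c < ennreal (\<bar>f x - f y\<bar> / dist x y)})"
    unfolding slope_def by (auto simp: less_SUP_iff)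
  moreover have "open {x. y \<noteq> x \<and> dist y x < h \<and> c < ennreal (\<bar>f x - f y\<bar> / dist x y)}" for y
  proof -
    have "open {x. y \<noteq> x}" by (simp add: open_Collect_neq)
    moreover have "open {x. dist y x < h}"
      by (intro open_Collect_less continuous_intros)
    moreover have "open ((\<lambda>x. ennreal (\<bar>f x - f y\<bar> / dist x y)) -` {c<..} \<inter> {x. y \<noteq> x})"
      by (intro continuous_on_open_vimage[OF \<open>open {x. y \<noteq> x}\<close>, THEN iffD1, rule_format]
          continuous_on_ennreal continuous_intros continuous_on_subset[OF f]) auto
    ultimately have "open ({x. y \<noteq> x} \<inter> {x. dist y x < h} \<inter>
        ((\<lambda>x. ennreal (\<bar>f x - f y\<bar> / dist x y)) -` {c<..} \<inter> {x. y \<noteq> x}))"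
      by (rule open_Int[OF open_Int])
    also have "\<dots> = {x. y \<noteq> x \<and> dist y x < h \<and> c < ennreal (\<bar>f x - f y\<bar> / dist x y)}" by auto
    finally show ?thesis .
  qed
  ultimately show "{x \<in> space borel. c < slope f h x} \<in> sets borel"
    by (auto intro!: borel_open open_UN)
qed

lemma grad_norm_measurable:
  assumes "f \<in> Lip"
  shows "grad_norm f \<in> borel_measurable borel"
proof -
  have "grad_norm f = (\<lambda>x. enn2real (INF n. slope f (inverse (real (Suc n))) x))"
    unfolding grad_norm_def
    by (subst Limsup_quotient_eq_INF_slope[OF _ LIMSEQ_inverse_real_of_nat]) auto
  moreover have "(\<lambda>x. enn2real (INF n. slope f (inverse (real (Suc n))) x)) \<in> borel_measurable borel"
    using slope_measurable[OF assms] by measurable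
  ultimately show ?thesis by simp
qed

text \<open>The comparison is required only near \<open>x\<close>, so a nonlinear function of
  \<open>f\<close> can be bounded by a local Lipschitz constant times \<open>f\<close>.\<close>

lemma grad_norm_le_mult:
  assumes "f \<in> Lip" "0 \<le> c"
    and "eventually (\<lambda>y. \<bar>u x - u y\<bar> \<le> c * \<bar>f x - f y\<bar>) (at x)"
  shows "grad_norm u x \<le> c * grad_norm f x"
proof -
  have "Limsup (at x) (\<lambda>y. ennreal (\<bar>u x - u y\<bar> / dist x y))
      \<le> Limsup (at x) (\<lambda>y. ennreal c * ennreal (\<bar>f x - f y\<bar> / dist x y))"
    using assms(3) \<open>0 \<le> c\<close>
    by (intro Limsup_mono) (auto elim!: eventually_mono simp: divide_right_mono ennreal_leI simp flip: ennreal_mult)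
  also have "\<dots> = ennreal c * Limsup (at x) (\<lambda>y. ennreal (\<bar>f x - f y\<bar> / dist x y))"
  \<comment> \<open>At an isolated point both limsups run over the trivial filter and equal 0.
    Elsewhere multiplication by the finite number \<open>ennreal c\<close> is monotone and
    continuous, hence commutes with the limsup.\<close>
  proof (cases "at x = bot")
    case False
    then show ?thesis
      by (intro Limsup_compose_continuous_mono)
        (auto intro!: monoI mult_left_mono ennreal_continuous_on_cmult)
  qed (simp add: bot_ennreal)
  also have "\<dots> = ennreal (c * grad_norm f x)"
    using assms by (simp add: ennreal_mult grad_norm_nonneg ennreal_grad_norm)
  finally show ?thesis
    unfolding grad_norm_def[of u]
    using assms(2) grad_norm_nonneg[of f x] by (intro enn2real_leI) (auto intro: mult_nonneg_nonneg)
qed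

lemma grad_norm_uminus: "grad_norm (\<lambda>x. - f x) = grad_norm f"
  unfolding grad_norm_def by (auto simp: abs_minus_commute add.commute)

lemma grad_norm_diff_const: "grad_norm (\<lambda>x. f x - c) = grad_norm f"
  unfolding grad_norm_def by simp

section \<open>Chain rule for powers of the positive part\<close>

lemma posp_powr_diff_le:
  fixes a b p :: real
  assumes "1 < p"
  shows "\<bar>max a 0 powr p - max b 0 powr p\<bar> \<le> p * max \<bar>a\<bar> \<bar>b\<bar> powr (p - 1) * \<bar>a - b\<bar>"
proof -
  \<comment> \<open>Mean value theorem: the derivative of \<open>x powr p\<close> increases because
    \<open>1 < p\<close>, so it is largest at the right endpoint \<open>s\<close>.\<close>
  have main: "s powr p - t powr p \<le> p * s powr (p - 1) * (s - t)" if "0 \<le> t" "t < s" for s t :: real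
  proof -
    have "((\<lambda>x. x powr p) has_derivative (\<lambda>d. p * x powr (p - 1) * d)) (at x)" if "t < x" "x < s" for x
      using has_real_derivative_powr[of x p] that \<open>0 \<le> t\<close> by (simp add: has_field_derivative_def)
    moreover have "continuous_on {t..s} (\<lambda>x. x powr p)"
      using that assms by (intro continuous_on_powr' continuous_intros) auto
    ultimately obtain \<xi> where \<xi>: "t < \<xi>" "\<xi> < s" "s powr p - t powr p = p * \<xi> powr (p - 1) * (s - t)"
      using mvt[OF \<open>t < s\<close>, of "\<lambda>x. x powr p" "\<lambda>x d. p * x powr (p - 1) * d"] by blast
    have "\<xi> powr (p - 1) \<le> s powr (p - 1)"
      using \<xi> that assms by (intro powr_mono2) auto
    then show ?thesis
      using \<xi> that assms by (auto intro!: mult_right_mono mult_left_mono)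
  qed
  have abs: "\<bar>s powr p - t powr p\<bar> \<le> p * max s t powr (p - 1) * \<bar>s - t\<bar>" if "0 \<le> s" "0 \<le> t" for s t
  proof (cases s t rule: linorder_cases)
    case less
    then have "s powr p \<le> t powr p" using assms that by (intro powr_mono2) auto
    then show ?thesis using main[OF that(1) less] less by (simp add: max_def abs_if)
  next
    case greater
    then have "t powr p \<le> s powr p" using assms that by (intro powr_mono2) auto
    then show ?thesis using main[OF that(2) greater] greater by (simp add: max_def abs_if)
  qed simp
  have "\<bar>max a 0 powr p - max b 0 powr p\<bar> \<le> p * max (max a 0) (max b 0) powr (p - 1) * \<bar>max a 0 - max b 0\<bar>"
    by (intro abs) auto
  also have "\<dots> \<le> p * max \<bar>a\<bar> \<bar>b\<bar> powr (p - 1) * \<bar>a - b\<bar>"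
    using assms by (intro mult_mono powr_mono2) auto
  finally show ?thesis .
qed

text \<open>By continuity \<open>|f y|\<close> stays below \<open>|f x| + d\<close> near
  \<open>x\<close>, so the increment bound holds there with a constant depending only on
  \<open>d\<close>. Then \<open>d\<close> tends to 0.\<close>

lemma grad_norm_posp_powr:
  assumes f: "f \<in> Lip" and p: "1 < p"
  shows "grad_norm (\<lambda>x. max (f x) 0 powr p) x \<le> p * \<bar>f x\<bar> powr (p - 1) * grad_norm f x"
proof (rule tendsto_lowerbound)
  have "eventually (\<lambda>d. 0 \<le> \<bar>f x\<bar> + d) (at_right 0)"
    by (rule eventually_at_rightI[of 0 1]) auto
  then have "((\<lambda>d. (\<bar>f x\<bar> + d) powr (p - 1)) \<longlongrightarrow> (\<bar>f x\<bar> + 0) powr (p - 1)) (at_right 0)"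
    using p by (intro tendsto_powr' tendsto_add tendsto_const tendsto_ident_at) auto
  then have "((\<lambda>d. p * (\<bar>f x\<bar> + d) powr (p - 1) * grad_norm f x)
      \<longlongrightarrow> p * (\<bar>f x\<bar> + 0) powr (p - 1) * grad_norm f x) (at_right 0)"
    by (intro tendsto_mult tendsto_const)
  then show "((\<lambda>d. p * (\<bar>f x\<bar> + d) powr (p - 1) * grad_norm f x)
      \<longlongrightarrow> p * \<bar>f x\<bar> powr (p - 1) * grad_norm f x) (at_right 0)" by simp
  show "eventually (\<lambda>d. grad_norm (\<lambda>x. max (f x) 0 powr p) x \<le> p * (\<bar>f x\<bar> + d) powr (p - 1) * grad_norm f x)
      (at_right 0)"
  proof (rule eventually_at_rightI[of 0 1])
    fix d :: real assume "d \<in> {0<..<1}"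
    then have d: "d > 0" by simp
    have "isCont f x"
      using Lip_continuous[OF f] by (simp add: continuous_on_eq_continuous_at)
    then have "eventually (\<lambda>y. dist (f y) (f x) < d) (at x)"
      using d by (simp add: isCont_def tendsto_iff)
    then have "eventually (\<lambda>y. \<bar>max (f x) 0 powr p - max (f y) 0 powr p\<bar>
        \<le> p * (\<bar>f x\<bar> + d) powr (p - 1) * \<bar>f x - f y\<bar>) (at x)"
    proof eventually_elim
      case (elim y)
      have "\<bar>max (f x) 0 powr p - max (f y) 0 powr p\<bar> \<le> p * max \<bar>f x\<bar> \<bar>f y\<bar> powr (p - 1) * \<bar>f x - f y\<bar>"
        by (rule posp_powr_diff_le[OF p])
      also have "\<dots> \<le> p * (\<bar>f x\<bar> + d) powr (p - 1) * \<bar>f x - f y\<bar>"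
        using p elim d by (intro mult_mono powr_mono2) (auto simp: dist_real_def)
      finally show ?case .
    qed
    then show "grad_norm (\<lambda>x. max (f x) 0 powr p) x \<le> p * (\<bar>f x\<bar> + d) powr (p - 1) * grad_norm f x"
      using p by (intro grad_norm_le_mult[OF f]) auto
  qed simp
qed simp

text \<open>For \<open>1 < p\<close> the power has unbounded derivative; the bound \<open>B\<close>
  controls it on the range of \<open>f\<close>. This is the reason why unbounded functions are
  truncated later.\<close>

lemma posp_powr_Lip:
  assumes f: "f \<in> Lip" and p: "1 < p" and bdd: "\<And>x. \<bar>f x\<bar> \<le> B"
  shows "(\<lambda>x. max (f x) 0 powr p) \<in> Lip"
proof -
  obtain L where L: "L-lipschitz_on UNIV f" using f by (auto simp: Lip_def)
  have "(p * B powr (p - 1) * L)-lipschitz_on UNIV (\<lambda>x. max (f x) 0 powr p)"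
  proof (rule lipschitz_onI)
    fix x y
    have "\<bar>max (f x) 0 powr p - max (f y) 0 powr p\<bar> \<le> p * max \<bar>f x\<bar> \<bar>f y\<bar> powr (p - 1) * \<bar>f x - f y\<bar>"
      by (rule posp_powr_diff_le[OF p])
    also have "\<dots> \<le> p * B powr (p - 1) * (L * dist x y)"
      using p bdd lipschitz_onD[OF L, of x y] by (intro mult_mono powr_mono2) (auto simp: dist_real_def)
    finally show "dist (max (f x) 0 powr p) (max (f y) 0 powr p) \<le> p * B powr (p - 1) * L * dist x y"
      by (simp add: dist_real_def mult.assoc)
  qed (use p lipschitz_on_nonneg[OF L] in auto)
  then show ?thesis by (auto simp: Lip_def)
qed

lemma Lip_compose_contraction:
  assumes "f \<in> Lip" "\<And>s t. \<bar>\<phi> s - \<phi> t\<bar> \<le> \<bar>s - t\<bar>"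
  shows "(\<lambda>x. \<phi> (f x)) \<in> Lip"
proof -
  obtain L where L: "L-lipschitz_on UNIV f" using assms(1) by (auto simp: Lip_def)
  have "L-lipschitz_on UNIV (\<lambda>x. \<phi> (f x))"
    using lipschitz_onD[OF L] lipschitz_on_nonneg[OF L]
    by (intro lipschitz_onI) (auto simp: dist_real_def intro: order_trans[OF assms(2)])
  then show ?thesis by (auto simp: Lip_def)
qed

lemma grad_norm_compose_contraction:
  assumes "f \<in> Lip" "\<And>s t. \<bar>\<phi> s - \<phi> t\<bar> \<le> \<bar>s - t\<bar>"
  shows "grad_norm (\<lambda>x. \<phi> (f x)) x \<le> grad_norm f x"
  using grad_norm_le_mult[OF assms(1), of 1 "\<lambda>x. \<phi> (f x)" x] assms(2) by simp

section \<open>The coarea inequality\<close>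

lemma mem_enlargement_iff: "x \<in> enlargement A h \<longleftrightarrow> (\<exists>a\<in>A. dist x a < h)"
proof (cases "A = {}")
  case False
  then show ?thesis
    unfolding enlargement_def infdist_def by (auto simp: cINF_less_iff)
qed (simp add: enlargement_def)

text \<open>Its strict superlevel sets are the \<open>h\<close>-enlargements of those of
  \<open>u\<close>. The measure gained by enlarging, integrated over all levels, thereby becomes the
  integral of \<open>ball_sup u h - u\<close>.\<close>

definition ball_sup :: "('a::metric_space \<Rightarrow> real) \<Rightarrow> real \<Rightarrow> 'a \<Rightarrow> real" where
  "ball_sup u h x = (SUP y\<in>ball x h. u y)"

lemma ball_sup_bdd:
  assumes "u \<in> Lip"
  shows "bdd_above (u ` ball x h)"
proof -
  obtain L where L: "L-lipschitz_on UNIV u" using assms by (auto simp: Lip_def)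
  have "u y \<le> u x + L * h" if "y \<in> ball x h" for y
  proof -
    have "\<bar>u x - u y\<bar> \<le> L * dist x y"
      using lipschitz_onD[OF L] by (simp add: dist_real_def)
    also have "\<dots> \<le> L * h"
      using that lipschitz_on_nonneg[OF L] by (intro mult_left_mono) auto
    finally show ?thesis by linarith
  qed
  then show ?thesis by (intro bdd_aboveI2) auto
qed

lemma less_ball_sup_iff:
  assumes "u \<in> Lip" "0 < h"
  shows "t < ball_sup u h x \<longleftrightarrow> x \<in> enlargement {x. t < u x} h"
  unfolding ball_sup_def mem_enlargement_iff
  using assms by (subst less_cSUP_iff[OF _ ball_sup_bdd]) auto

lemma le_ball_sup:
  assumes "u \<in> Lip" "0 < h"
  shows "u x \<le> ball_sup u h x"
  unfolding ball_sup_def using assms by (intro cSUP_upper ball_sup_bdd) auto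

lemma open_enlargement: "open (enlargement A h)"
proof -
  have "enlargement A h = (\<Union>a\<in>A. ball a h)"
    by (auto simp: mem_enlargement_iff dist_commute)
  then show ?thesis by auto
qed

lemma ball_sup_measurable:
  assumes "u \<in> Lip" "0 < h"
  shows "ball_sup u h \<in> borel_measurable borel"
  using less_ball_sup_iff[OF assms]
  by (intro borel_measurableI_greater) (auto intro: borel_open open_enlargement)

lemma ball_sup_diff_le:
  assumes "u \<in> Lip" "0 < h"
  shows "ennreal (ball_sup u h x - u x) \<le> ennreal h * slope u h x"
proof -
  obtain L where L: "L-lipschitz_on UNIV u" using assms by (auto simp: Lip_def)
  obtain s where s: "slope u h x = ennreal s" "0 \<le> s"
    using slope_le_lipschitz[OF L, of h x] by (cases "slope u h x") (auto simp: top_unique)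
  have "u y \<le> u x + h * s" if "y \<in> ball x h" for y
    using le_slope[of x y h u] that s assms(2) by (simp flip: ennreal_mult) 
  then have "ball_sup u h x \<le> u x + h * s"
    unfolding ball_sup_def using assms by (intro cSUP_least) auto
  then show ?thesis
    using assms s by (simp flip: ennreal_mult add: ennreal_leI)
qed

text \<open>Replaces the continuous parameter of the Minkowski content by a sequence of radii, to
  which Fatou's lemma applies.\<close>

lemma Liminf_at_right_le_liminf:
  fixes F :: "real \<Rightarrow> 'b::complete_lattice"
  assumes "\<And>n. 0 < h n" "h \<longlonglongrightarrow> (0::real)"
  shows "Liminf (at_right 0) F \<le> liminf (\<lambda>n. F (h n))"
  unfolding Liminf_def[of "at_right 0"]
proof (rule SUP_least)
  fix P assume "P \<in> {P. eventually P (at_right (0::real))}"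
  then have "eventually P (at_right 0)" by simp
  moreover have "filterlim h (at_right 0) sequentially"
    using assms by (intro tendsto_imp_filterlim_at_right) auto
  ultimately have "eventually (\<lambda>n. P (h n)) sequentially"
    by (rule eventually_compose_filterlim)
  then show "Inf (F ` {x. P x}) \<le> liminf (\<lambda>n. F (h n))"
    by (intro Liminf_bounded) (auto elim!: eventually_mono intro: INF_lower)
qed

text \<open>Monotone convergence for a decreasing sequence needs one finite integral; it comes from
  the Lipschitz constant and the finiteness of \<open>N\<close>.\<close>

lemma nn_integral_slope_tendsto:
  fixes N :: "'a::metric_space measure"
  assumes "finite_measure N" "sets N = sets borel" "u \<in> Lip" "decseq h" "\<And>n. 0 < h n" "h \<longlonglongrightarrow> 0"
  shows "(INF n. \<integral>\<^sup>+x. slope u (h n) x \<partial>N) = (\<integral>\<^sup>+x. ennreal (grad_norm u x) \<partial>N)"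
proof -
  interpret finite_measure N by fact
  obtain L where L: "L-lipschitz_on UNIV u" using assms by (auto simp: Lip_def)
  have meas: "slope u (h n) \<in> borel_measurable N" for n
    using slope_measurable[OF assms(3)] by (simp add: measurable_cong_sets[OF assms(2) refl])
  have "(\<integral>\<^sup>+x. slope u (h 0) x \<partial>N) \<le> (\<integral>\<^sup>+x. ennreal L \<partial>N)"
    by (intro nn_integral_mono slope_le_lipschitz[OF L])
  also have "\<dots> < \<infinity>"
    by (simp add: ennreal_mult_eq_top_iff emeasure_finite less_top[symmetric])
  finally have "(\<integral>\<^sup>+x. (INF n. slope u (h n) x) \<partial>N) = (INF n. \<integral>\<^sup>+x. slope u (h n) x \<partial>N)"
    using assms(4) meas
    by (intro nn_integral_monotone_convergence_INF_decseq[where i = 0])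
      (auto simp: monotone_def le_fun_def intro: slope_mono)
  then show ?thesis
    by (simp add: ennreal_grad_norm[OF assms(3)] Limsup_quotient_eq_INF_slope[OF assms(5,6)])
qed

section \<open>Superlevel sets of a Lipschitz function with support of finite measure\<close>

context
  fixes M :: "'a::metric_space measure" and u :: "'a \<Rightarrow> real"
  assumes sets_M: "sets M = sets borel"
    and u: "u \<in> Lip" and u_nonneg: "\<And>x. 0 \<le> u x"
    and finite_support: "emeasure M {x. 0 < u x} < \<infinity>"
begin

text \<open>The restriction of \<open>M\<close> to the set where \<open>u\<close> is positive. It is
  finite, hence sigma-finite, which Fubini's theorem requires and which is not assumed of
  \<open>M\<close>.\<close>

private definition N where "N = density M (indicator {x. 0 < u x})"

lemma superlevel_set_measurable: "{x. t < u x} \<in> sets M"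
proof -
  have "open {x. t < u x}"
    by (intro open_Collect_less continuous_intros continuous_on_subset[OF Lip_continuous[OF u]]) auto
  then show ?thesis by (simp add: sets_M)
qed

private lemma sets_N: "sets N = sets borel"
  by (simp add: N_def sets_M)

private lemma emeasure_N: "B \<in> sets M \<Longrightarrow> emeasure N B = emeasure M ({x. 0 < u x} \<inter> B)"
  unfolding N_def using superlevel_set_measurable[of 0]
  by (rule emeasure_restricted)

private lemma finite_N: "finite_measure N"
proof
  have "UNIV \<in> sets M" by (simp add: sets_M)
  then show "emeasure N (space N) \<noteq> \<infinity>"
    using finite_support emeasure_N[of UNIV] sets_eq_imp_space_eq[OF sets_N] by simp
qed

private lemma nn_integral_N:
  "f \<in> borel_measurable borel \<Longrightarrow> (\<integral>\<^sup>+x. f x \<partial>N) = (\<integral>\<^sup>+x. indicator {x. 0 < u x} x * f x \<partial>M)"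
  unfolding N_def using superlevel_set_measurable[of 0]
  by (subst nn_integral_density) (auto simp: measurable_cong_sets[OF sets_M refl] sets_M)

private lemma pair_N: "pair_sigma_finite N lborel"
  using finite_measure.axioms(1)[OF finite_N] lborel.sigma_finite_measure_axioms
  by (simp add: pair_sigma_finite_def)

text \<open>The restriction \<open>t > \<epsilon>\<close> keeps the enlargements inside the set \<open>{u > 0}\<close> of finite measure; without it
  they could have infinite measure for every \<open>h > 0\<close>, since the space need not be locally compact.\<close>

private lemma superlevel_increment_integral:
  assumes "0 < \<epsilon>" "0 < h" and L: "L-lipschitz_on UNIV u" and "L * h \<le> \<epsilon>"
  shows "(\<lambda>t. indicator {\<epsilon><..} t * (emeasure M (enlargement {x. t < u x} h) - emeasure M {x. t < u x}))
      \<in> borel_measurable borel" (is ?meas)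
    and "(\<integral>\<^sup>+t. indicator {\<epsilon><..} t *
          (emeasure M (enlargement {x. t < u x} h) - emeasure M {x. t < u x}) \<partial>lborel)
      \<le> ennreal h * (\<integral>\<^sup>+x. slope u h x \<partial>N)" (is ?bound)
proof -
  interpret pair_sigma_finite N lborel by (rule pair_N)
  \<comment> \<open>A point \<open>x\<close> lies in the enlargement of \<open>{u > t}\<close> but
    not in \<open>{u > t}\<close> itself exactly when \<open>u x \<le> t < ball_sup u h x\<close>.
    This region of the product space is measured in both orders.\<close>
  let ?g = "\<lambda>x t. indicator {\<epsilon><..} t * indicator {p. u (fst p) \<le> snd p \<and> snd p < ball_sup u h (fst p)} (x, t) :: ennreal"
  have [measurable]: "u \<in> borel_measurable N" "ball_sup u h \<in> borel_measurable N" "slope u h \<in> borel_measurable N"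
    using Lip_measurable[OF u] ball_sup_measurable[OF u \<open>0 < h\<close>] slope_measurable[OF u]
    by (simp_all add: measurable_cong_sets[OF sets_N refl])
  have g: "case_prod ?g \<in> borel_measurable (N \<Otimes>\<^sub>M lborel)"
    by measurable
  have eq: "indicator {\<epsilon><..} t * (emeasure M (enlargement {x. t < u x} h) - emeasure M {x. t < u x})
      = (\<integral>\<^sup>+x. ?g x t \<partial>N)" for t
  proof (cases "\<epsilon> < t")
    case True
    have sub: "enlargement {x. t < u x} h \<subseteq> {x. 0 < u x}"
    proof
      fix x assume "x \<in> enlargement {x. t < u x} h"
      then obtain y where y: "t < u y" "dist x y < h" by (auto simp: mem_enlargement_iff)
      have "\<bar>u x - u y\<bar> \<le> L * dist x y"
        using lipschitz_onD[OF L] by (simp add: dist_real_def)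
      also have "\<dots> \<le> L * h"
        using y lipschitz_on_nonneg[OF L] by (intro mult_left_mono) auto
      finally show "x \<in> {x. 0 < u x}" using y True assms(4) by simp
    qed
    have sub2: "{x. t < u x} \<subseteq> enlargement {x. t < u x} h"
      using \<open>0 < h\<close> by (auto simp: mem_enlargement_iff) (metis dist_self)
    have fin: "emeasure M {x. t < u x} \<noteq> \<infinity>"
    proof -
      have "emeasure M {x. t < u x} \<le> emeasure M {x. 0 < u x}"
        using True assms(1) by (intro emeasure_mono superlevel_set_measurable) auto
      then show ?thesis using finite_support by (auto simp: top_unique)
    qed
    have E: "enlargement {x. t < u x} h \<in> sets M"
      by (simp add: sets_M borel_open open_enlargement)
    have "emeasure M (enlargement {x. t < u x} h) - emeasure M {x. t < u x}
        = emeasure M (enlargement {x. t < u x} h - {x. t < u x})"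
      using E fin sub2 superlevel_set_measurable by (intro emeasure_Diff[symmetric]) auto
    also have "\<dots> = emeasure N (enlargement {x. t < u x} h - {x. t < u x})"
      using sub by (subst emeasure_N) (auto intro!: sets.Diff E superlevel_set_measurable arg_cong[where f = "emeasure M"])
    also have "\<dots> = (\<integral>\<^sup>+x. indicator (enlargement {x. t < u x} h - {x. t < u x}) x \<partial>N)"
      using E superlevel_set_measurable sets_N sets_M by (intro nn_integral_indicator[symmetric]) auto
    also have "\<dots> = (\<integral>\<^sup>+x. ?g x t \<partial>N)"
      using True by (intro nn_integral_cong) (auto simp: indicator_def less_ball_sup_iff[OF u \<open>0 < h\<close>])
    finally show ?thesis using True by simp
  qed simp
  show ?meas
    unfolding eq by (intro M1.borel_measurable_nn_integral) (use g in \<open>simp add: measurable_pair_swap_iff[of _ N] split_beta'\<close>)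
  \<comment> \<open>For fixed \<open>x\<close> the section in \<open>t\<close> lies in an interval
    of length \<open>ball_sup u h x - u x\<close>, which is at most \<open>h\<close> times the slope
    at scale \<open>h\<close>.\<close>
  have "(\<integral>\<^sup>+t. (\<integral>\<^sup>+x. ?g x t \<partial>N) \<partial>lborel) = (\<integral>\<^sup>+x. (\<integral>\<^sup>+t. ?g x t \<partial>lborel) \<partial>N)"
    by (rule Fubini'[OF g])
  also have "\<dots> \<le> (\<integral>\<^sup>+x. ennreal h * slope u h x \<partial>N)"
  proof (intro nn_integral_mono)
    fix x
    have "(\<integral>\<^sup>+t. ?g x t \<partial>lborel) \<le> (\<integral>\<^sup>+t. indicator {u x..<ball_sup u h x} t \<partial>lborel)"
      by (intro nn_integral_mono) (auto simp: indicator_def)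
    also have "\<dots> = ennreal (ball_sup u h x - u x)"
      using le_ball_sup[OF u \<open>0 < h\<close>, of x] by simp
    also have "\<dots> \<le> ennreal h * slope u h x" by (rule ball_sup_diff_le[OF u \<open>0 < h\<close>])
    finally show "(\<integral>\<^sup>+t. ?g x t \<partial>lborel) \<le> ennreal h * slope u h x" .
  qed
  also have "\<dots> = ennreal h * (\<integral>\<^sup>+x. slope u h x \<partial>N)"
    by (rule nn_integral_cmult) measurable
  finally show ?bound unfolding eq .
qed

text \<open>Layer-cake formula on the left; at each level the hypothesis bounds the measure by
  \<open>Q\<close> times the Minkowski content. Fatou's lemma moves the liminf outside the integral
  over levels, where \<open>superlevel_increment_integral\<close> bounds the difference quotients by
  integrals of slopes, and these decrease to the integral of the gradient.\<close>

lemma coarea_isoperimetric: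
  assumes A: "A \<in> sets M"
    and iso: "\<And>t. 0 < t \<Longrightarrow> emeasure M (A \<inter> {x. t < u x}) \<le> Q * iso_profile M (emeasure M {x. t < u x})"
  shows "(\<integral>\<^sup>+x. indicator A x * ennreal (u x) \<partial>M) \<le> Q * (\<integral>\<^sup>+x. ennreal (grad_norm u x) \<partial>M)"
proof (rule ennreal_le_epsilon)
  fix e :: real assume "0 < e"
  interpret pair_sigma_finite N lborel by (rule pair_N)
  interpret N: finite_measure N by (rule finite_N)
  obtain L where L: "L-lipschitz_on UNIV u" using u by (auto simp: Lip_def)
  have "L \<ge> 0" by (rule lipschitz_on_nonneg[OF L])
  \<comment> \<open>Discarding the levels up to \<open>\<epsilon>\<close> costs at most
    \<open>\<epsilon>\<close> times the mass of \<open>N\<close>, which this choice keeps below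
    \<open>e\<close>. The added 1 guards against zero mass.\<close>
  define \<epsilon> where "\<epsilon> = e / (measure N (space N) + 1)"
  have "\<epsilon> > 0" unfolding \<epsilon>_def using \<open>0 < e\<close> by (intro divide_pos_pos) (auto intro: add_nonneg_pos)
  \<comment> \<open>Radii decreasing to 0 with \<open>L * h n \<le> \<epsilon>\<close>, as the
    increment estimate demands; \<open>L + 1\<close> is used because \<open>L\<close> may be
    0.\<close>
  define h where "h n = \<epsilon> / (L + 1) * inverse (real (Suc n))" for n
  have h_pos: "0 < h n" for n
    unfolding h_def using \<open>\<epsilon> > 0\<close> \<open>L \<ge> 0\<close> by (intro mult_pos_pos) auto
  have h_lim: "h \<longlonglongrightarrow> 0"
    unfolding h_def using tendsto_mult[OF tendsto_const LIMSEQ_inverse_real_of_nat, of "\<epsilon> / (L + 1)"] by simp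
  have h_dec: "decseq h"
    unfolding h_def decseq_def using \<open>\<epsilon> > 0\<close> \<open>L \<ge> 0\<close>
    by (intro allI impI mult_left_mono le_imp_inverse_le divide_nonneg_nonneg) auto
  have h_small: "L * h n \<le> \<epsilon>" for n
  proof -
    have "L * h n = \<epsilon> * (L / (L + 1)) * inverse (real (Suc n))" by (simp add: h_def)
    also have "\<dots> \<le> \<epsilon> * 1 * 1"
      using \<open>\<epsilon> > 0\<close> \<open>L \<ge> 0\<close> by (intro mult_mono) (auto simp: field_simps)
    finally show ?thesis by simp
  qed
  define D where "D n t = indicator {\<epsilon><..} t *
      (emeasure M (enlargement {x. t < u x} (h n)) - emeasure M {x. t < u x})" for n t
  have D: "D n \<in> borel_measurable borel" "(\<integral>\<^sup>+t. D n t \<partial>lborel) \<le> ennreal (h n) * (\<integral>\<^sup>+x. slope u (h n) x \<partial>N)" for n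
    unfolding D_def using superlevel_increment_integral[OF \<open>\<epsilon> > 0\<close> h_pos L h_small] by auto
  have [measurable]: "u \<in> borel_measurable N" "A \<in> sets N"
    using Lip_measurable[OF u] A by (simp_all add: measurable_cong_sets[OF sets_N refl] sets_N sets_M)
  let ?g = "\<lambda>x t. indicator A x * indicator {p. \<epsilon> < snd p \<and> snd p < u (fst p)} (x, t) :: ennreal"
  have g: "case_prod ?g \<in> borel_measurable (N \<Otimes>\<^sub>M lborel)"
    by measurable
  have "(\<integral>\<^sup>+x. indicator A x * ennreal (u x) \<partial>M) = (\<integral>\<^sup>+x. indicator A x * ennreal (u x) \<partial>N)"
    using A u_nonneg Lip_measurable[OF u] unfolding sets_M
    by (subst nn_integral_N) (auto intro!: nn_integral_cong simp: indicator_def not_less dest: antisym[OF _ u_nonneg])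
  also have "\<dots> \<le> (\<integral>\<^sup>+x. (\<integral>\<^sup>+t. ?g x t \<partial>lborel) + ennreal \<epsilon> \<partial>N)"
  proof (intro nn_integral_mono)
    fix x
    have "(\<integral>\<^sup>+t. ?g x t \<partial>lborel) = (\<integral>\<^sup>+t. indicator A x * indicator {\<epsilon><..<u x} t \<partial>lborel)"
      by (intro nn_integral_cong) (auto simp: indicator_def)
    also have "\<dots> = indicator A x * ennreal (u x - \<epsilon>)"
      by (cases "\<epsilon> \<le> u x") (auto simp: nn_integral_cmult ennreal_neg)
    finally show "indicator A x * ennreal (u x) \<le> (\<integral>\<^sup>+t. ?g x t \<partial>lborel) + ennreal \<epsilon>"
      using \<open>\<epsilon> > 0\<close> by (cases "\<epsilon> \<le> u x") (auto simp: indicator_def ennreal_leI ennreal_neg simp flip: ennreal_plus)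
  qed
  also have "\<dots> = (\<integral>\<^sup>+x. (\<integral>\<^sup>+t. ?g x t \<partial>lborel) \<partial>N) + ennreal \<epsilon> * emeasure N (space N)"
    by (subst nn_integral_add) (use lborel.borel_measurable_nn_integral[OF g] in auto)
  also have "(\<integral>\<^sup>+x. (\<integral>\<^sup>+t. ?g x t \<partial>lborel) \<partial>N) = (\<integral>\<^sup>+t. (\<integral>\<^sup>+x. ?g x t \<partial>N) \<partial>lborel)"
    by (rule Fubini'[OF g, symmetric])
  also have "\<dots> \<le> (\<integral>\<^sup>+t. Q * liminf (\<lambda>n. D n t / ennreal (h n)) \<partial>lborel)"
  proof (intro nn_integral_mono)
    fix t :: real
    show "(\<integral>\<^sup>+x. ?g x t \<partial>N) \<le> Q * liminf (\<lambda>n. D n t / ennreal (h n))"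
    proof (cases "\<epsilon> < t")
      case True
      have "(\<integral>\<^sup>+x. ?g x t \<partial>N) = (\<integral>\<^sup>+x. indicator (A \<inter> {x. t < u x}) x \<partial>N)"
        using True by (intro nn_integral_cong) (auto simp: indicator_def)
      also have "\<dots> = emeasure N (A \<inter> {x. t < u x})"
        using A superlevel_set_measurable sets_N sets_M by (intro nn_integral_indicator) auto
      also have "\<dots> = emeasure M (A \<inter> {x. t < u x})"
        using A superlevel_set_measurable True \<open>\<epsilon> > 0\<close>
        by (subst emeasure_N) (auto intro!: arg_cong[where f = "emeasure M"])
      also have "\<dots> \<le> Q * iso_profile M (emeasure M {x. t < u x})"
        using True \<open>\<epsilon> > 0\<close> by (intro iso) auto
      also have "\<dots> \<le> Q * minkowski_content M {x. t < u x}"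
        unfolding iso_profile_def using superlevel_set_measurable
        by (intro mult_left_mono INF_lower) (auto simp: sets_M)
      also have "\<dots> \<le> Q * liminf (\<lambda>n. D n t / ennreal (h n))"
        unfolding minkowski_content_def D_def using True h_pos
        by (intro mult_left_mono order_trans[OF Liminf_at_right_le_liminf[OF h_pos h_lim]]) auto
      finally show ?thesis .
    qed (auto simp: indicator_def not_less intro!: order_trans[OF eq_refl[OF nn_integral_0_iff_AE[THEN iffD2]]])
  qed
  also have "\<dots> = Q * (\<integral>\<^sup>+t. liminf (\<lambda>n. D n t / ennreal (h n)) \<partial>lborel)"
    using D by (intro nn_integral_cmult) (auto intro!: borel_measurable_liminf borel_measurable_divide_ennreal)
  also have "\<dots> \<le> Q * liminf (\<lambda>n. \<integral>\<^sup>+t. D n t / ennreal (h n) \<partial>lborel)"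
    using D by (intro mult_left_mono nn_integral_liminf) (auto intro!: borel_measurable_divide_ennreal)
  also have "\<dots> \<le> Q * liminf (\<lambda>n. \<integral>\<^sup>+x. slope u (h n) x \<partial>N)"
  proof (intro mult_left_mono Liminf_mono always_eventually allI)
    fix n
    have "(\<integral>\<^sup>+t. D n t / ennreal (h n) \<partial>lborel) = (\<integral>\<^sup>+t. D n t \<partial>lborel) / ennreal (h n)"
      using D(1)[of n] by (intro nn_integral_divide) auto
    also have "\<dots> \<le> (ennreal (h n) * (\<integral>\<^sup>+x. slope u (h n) x \<partial>N)) / ennreal (h n)"
      by (intro divide_right_mono_ennreal D)
    also have "\<dots> = (\<integral>\<^sup>+x. slope u (h n) x \<partial>N)"
      using h_pos[of n] by (subst mult.commute) (simp add: mult_divide_eq_ennreal)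
    finally show "(\<integral>\<^sup>+t. D n t / ennreal (h n) \<partial>lborel) \<le> (\<integral>\<^sup>+x. slope u (h n) x \<partial>N)" .
  qed auto
  also have "liminf (\<lambda>n. \<integral>\<^sup>+x. slope u (h n) x \<partial>N) = (INF n. \<integral>\<^sup>+x. slope u (h n) x \<partial>N)"
    using h_dec by (intro lim_imp_Liminf LIMSEQ_INF)
      (auto simp: decseq_def intro!: nn_integral_mono slope_mono)
  also have "\<dots> = (\<integral>\<^sup>+x. ennreal (grad_norm u x) \<partial>N)"
    by (rule nn_integral_slope_tendsto[OF finite_N sets_N u h_dec h_pos h_lim])
  also have "\<dots> \<le> (\<integral>\<^sup>+x. ennreal (grad_norm u x) \<partial>M)"
    using grad_norm_measurable[OF u]
    by (subst nn_integral_N) (auto intro!: nn_integral_mono simp: indicator_def)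
  also have "ennreal \<epsilon> * emeasure N (space N) \<le> ennreal e"
  proof -
    have "\<epsilon> * measure N (space N) \<le> e"
      unfolding \<epsilon>_def using \<open>0 < e\<close> measure_nonneg[of N "space N"]
      by (simp add: divide_le_eq add_nonneg_pos mult_left_mono)
    then show ?thesis
      using \<open>\<epsilon> > 0\<close> by (simp add: N.emeasure_eq_measure ennreal_leI flip: ennreal_mult)
  qed
  finally show "(\<integral>\<^sup>+x. indicator A x * ennreal (u x) \<partial>M)
      \<le> Q * (\<integral>\<^sup>+x. ennreal (grad_norm u x) \<partial>M) + ennreal e"
    by (simp add: mult_left_mono add_mono)
qed

end

section \<open>The isoperimetric profile\<close>

lemma ennreal_half_less_self: "0 < V \<Longrightarrow> V < \<infinity> \<Longrightarrow> V / 2 < (V::ennreal)"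
  by (cases V) (auto simp: ennreal_divide_numeral ennreal_less_iff)

context isoperimetric_space
begin

lemma profile_eq_ennreal:
  assumes "t < emeasure M (space M)"
  shows "iso_profile M t = ennreal (enn2real (iso_profile M t))"
  using profile_finite[OF assms] by (simp add: less_top)

lemma less_total_if_le_half:
  assumes "0 < t" "t < \<infinity>" "t \<le> emeasure M (space M) / 2"
  shows "t < emeasure M (space M)"
proof (cases "emeasure M (space M) = \<infinity>")
  case False
  moreover have "emeasure M (space M) \<noteq> 0" using assms by auto
  ultimately have "emeasure M (space M) / 2 < emeasure M (space M)"
    by (intro ennreal_half_less_self) (auto simp: less_top[symmetric] zero_less_iff_neq_zero)
  then show ?thesis using assms(3) by (rule le_less_trans[rotated])
qed (use assms in auto)

text \<open>A concave function vanishing at 0 lies above its chord from the origin, so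
  \<open>I(t) / t\<close> is non-increasing. The chord ends at \<open>b\<close> and is evaluated at
  \<open>a = (a / b) * b\<close>.\<close>

lemma profile_quotient_mono:
  assumes "0 < s" "s \<le> t" "t < emeasure M (space M)"
  shows "s / iso_profile M s \<le> t / iso_profile M t"
proof -
  have t_fin: "t < \<infinity>" using assms(3) by (rule less_le_trans) simp
  then have "s < \<infinity>" using assms(2) by (rule le_less_trans[rotated])
  obtain a where a: "s = ennreal a" "0 < a"
    using \<open>s < \<infinity>\<close> assms(1) by (cases s) (auto simp: ennreal_less_zero_iff)
  obtain b where b: "t = ennreal b" "0 \<le> b" using t_fin by (cases t) auto
  have ab: "a \<le> b" using assms(2) a b by (simp add: ennreal_le_iff)
  have s_less: "s < emeasure M (space M)" using assms(2,3) by (rule le_less_trans)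
  define i where "i t = enn2real (iso_profile M (ennreal t))" for t :: real
  have i: "iso_profile M s = ennreal (i a)" "iso_profile M t = ennreal (i b)"
    using profile_eq_ennreal[OF s_less] profile_eq_ennreal[OF assms(3)] by (simp_all add: i_def a b)
  have i_pos: "0 < i a" "0 < i b"
    using profile_pos[OF assms(1) s_less] profile_pos[OF _ assms(3)] assms i
    by (auto simp: ennreal_less_zero_iff)
  have "(1 - a / b) * i 0 + (a / b) * i b \<le> i ((1 - a / b) *\<^sub>R 0 + (a / b) *\<^sub>R b)"
    unfolding i_def using a ab b assms(3) zero_less_iff_neq_zero
    by (intro concave_onD[OF profile_concave]) (auto simp: order.strict_trans1[OF _ assms(3)])
  moreover have "i 0 = 0" by (simp add: i_def profile_zero)
  ultimately have "a / b * i b \<le> i a" using a ab by simp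
  then have "a / i a \<le> b / i b" using i_pos a ab by (simp add: field_simps)
  then show ?thesis
    using i a b i_pos ab by (simp add: divide_ennreal ennreal_leI)
qed

text \<open>For finite total measure \<open>V\<close>, the point \<open>t\<close> lies between
  \<open>s\<close> and \<open>V - s\<close>, where the profile takes equal values by symmetry;
  concavity makes it at least as large in between.\<close>

lemma profile_mono_half:
  assumes "0 < s" "s \<le> t" "t < \<infinity>" "t \<le> emeasure M (space M) / 2"
  shows "iso_profile M s \<le> iso_profile M t"
proof (cases "emeasure M (space M) = \<infinity>")
  case True
  then show ?thesis
    using assms by (intro mono_onD[OF profile_increasing]) auto
next
  case False
  then obtain v where v: "emeasure M (space M) = ennreal v" "0 \<le> v"
    by (cases "emeasure M (space M)") auto
  have "s < \<infinity>" using assms(2,3) by (rule le_less_trans)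
  then obtain a where a: "s = ennreal a" "0 < a"
    using assms(1) by (cases s) (auto simp: ennreal_less_zero_iff)
  obtain b where b: "t = ennreal b" "0 \<le> b" using assms(3) by (cases t) auto
  have ab: "a \<le> b" using assms(2) a b by (simp add: ennreal_le_iff)
  have bv: "b \<le> v / 2"
    using assms(4) b v by (simp add: ennreal_divide_numeral ennreal_le_iff)
  have less: "s < emeasure M (space M)" "t < emeasure M (space M)"
    using a b ab bv v by (auto simp: ennreal_less_iff)
  define i where "i t = enn2real (iso_profile M (ennreal t))" for t :: real
  have "iso_profile M (ennreal (v - a)) = iso_profile M s"
    using profile_symmetric[OF _ assms(1) less(1)] False v a by (simp add: ennreal_minus less_top)
  then have sym: "i (v - a) = i a" by (simp add: i_def a)
  show ?thesis
  proof (cases "a = b")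
    case False
    \<comment> \<open>The relative position of \<open>b\<close> in the interval from
      \<open>a\<close> to \<open>v - a\<close>. Having \<open>a \<noteq> b\<close> ensures that this
      interval is nondegenerate.\<close>
    define l0 where "l0 = (b - a) / (v - 2 * a)"
    have va: "0 < v - 2 * a" using ab bv False by simp
    have "l0 * (v - 2 * a) = b - a" using va by (simp add: l0_def)
    then have l: "b = (1 - l0) * a + l0 * (v - a)"
      by (simp add: algebra_simps)
    have l01: "0 \<le> l0" "l0 \<le> 1"
      using va ab bv by (auto simp: l0_def divide_le_eq)
    have "(1 - l0) * i a + l0 * i (v - a) \<le> i ((1 - l0) *\<^sub>R a + l0 *\<^sub>R (v - a))"
      unfolding i_def using l01 a va v
      by (intro concave_onD[OF profile_concave]) (auto simp: ennreal_less_iff)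
    then have "i a \<le> i b"
      unfolding real_scaleR_def l[symmetric] sym by (simp add: left_diff_distrib)
    then show ?thesis
      using profile_eq_ennreal[OF less(1)] profile_eq_ennreal[OF less(2)]
      by (metis i_def a(1) b(1) ennreal_leI)
  qed (simp add: a b)
qed

text \<open>\<open>Lim\<close> is informative only once convergence is known. Monotonicity of the
  quotient gives convergence to its supremum, which dominates every value.\<close>

lemma iso_quotient_le_infinity:
  assumes "emeasure M (space M) = \<infinity>" "0 < t" "t < \<infinity>"
  shows "t / iso_profile M t \<le> iso_quotient M \<infinity>"
proof -
  define q where "q s = ennreal s / iso_profile M (ennreal s)" for s :: real
  have mono: "q s \<le> q s'" if "0 < s" "s \<le> s'" for s s'
    unfolding q_def using that assms by (intro profile_quotient_mono) (auto simp: ennreal_leI)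
  have "(q \<longlongrightarrow> (SUP s\<in>{0<..}. q s)) at_top"
  proof (rule order_tendstoI)
    fix c assume "c < (SUP s\<in>{0<..}. q s)"
    then obtain s where s: "0 < s" "c < q s" by (auto simp: less_SUP_iff)
    show "eventually (\<lambda>x. c < q x) at_top"
      using eventually_ge_at_top[of s] by eventually_elim (use s mono in \<open>auto intro: less_le_trans\<close>)
  next
    fix c assume c: "(SUP s\<in>{0<..}. q s) < c"
    show "eventually (\<lambda>x. q x < c) at_top"
      using eventually_gt_at_top[of 0] by eventually_elim (auto intro!: le_less_trans[OF _ c] SUP_upper)
  qed
  then have "Lim at_top q = (SUP s\<in>{0<..}. q s)"
    by (intro tendsto_Lim) auto
  moreover obtain s where "t = ennreal s" "0 < s"
    using assms by (cases t) (auto simp: ennreal_less_zero_iff)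
  ultimately show ?thesis
    by (auto simp: iso_quotient_def q_def[abs_def] intro!: SUP_upper2[of s])
qed

text \<open>Here \<open>t\<close>, \<open>m\<close> and \<open>a\<close> stand for the measures of
  \<open>{u > t}\<close>, of \<open>A\<close> and of their intersection. Let \<open>b\<close> be the
  minimum and \<open>Q\<close> the quotient. If \<open>b \<le> t\<close>, then
  \<open>a \<le> b = Q(b) I(b) \<le> Q(b) I(t)\<close> since \<open>I\<close> increases; if
  \<open>t < b\<close>, then \<open>a \<le> t = Q(t) I(t) \<le> Q(b) I(t)\<close> since
  \<open>Q\<close> increases.\<close>

lemma le_iso_quotient_mult_profile:
  assumes "0 < t" "t < \<infinity>" "t \<le> emeasure M (space M) / 2" "a \<le> t" "a \<le> m"
  shows "a \<le> iso_quotient M (min m (emeasure M (space M) / 2)) * iso_profile M t"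
proof -
  define b where "b = min m (emeasure M (space M) / 2)"
  have ab: "a \<le> b" using assms unfolding b_def by auto
  have cancel: "s / iso_profile M s * iso_profile M s = s" if "0 < s" "s < emeasure M (space M)" for s
    using profile_pos[OF that] profile_finite[OF that(2)]
    by (simp add: ennreal_divide_times ennreal_divide_self zero_less_iff_neq_zero)
  have t_less: "t < emeasure M (space M)" using assms by (intro less_total_if_le_half)
  consider "b = 0" | "0 < b" "b \<le> t" | "t < b" "b < \<infinity>" | "b = \<infinity>"
    by (cases "b = 0"; cases "b = \<infinity>"; cases "b \<le> t") (auto simp: zero_less_iff_neq_zero less_top[symmetric])
  then have "a \<le> iso_quotient M b * iso_profile M t"
  proof cases
    case 1
    then show ?thesis using ab by simp
  next
    case 2
    have b_less: "b < emeasure M (space M)" using 2(2) t_less by (rule le_less_trans)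
    have "b \<noteq> \<infinity>" using 2 assms(2) by auto
    have "a \<le> b / iso_profile M b * iso_profile M b"
      using ab cancel[OF 2(1) b_less] by simp
    also have "\<dots> \<le> b / iso_profile M b * iso_profile M t"
      using 2 assms by (intro mult_left_mono profile_mono_half) auto
    finally show ?thesis using 2 \<open>b \<noteq> \<infinity>\<close> by (simp add: iso_quotient_def)
  next
    case 3
    have "0 < b" using 3(1) by (rule le_less_trans[rotated]) simp
    have "b \<le> emeasure M (space M) / 2" by (simp add: b_def)
    with 3 \<open>0 < b\<close> have b_less: "b < emeasure M (space M)"
      by (intro less_total_if_le_half)
    have "a \<le> t / iso_profile M t * iso_profile M t"
      using assms cancel[OF assms(1) t_less] by simp
    also have "\<dots> \<le> b / iso_profile M b * iso_profile M t"
      using 3 assms b_less by (intro mult_right_mono profile_quotient_mono) auto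
    finally show ?thesis using 3 \<open>0 < b\<close> by (auto simp: iso_quotient_def)
  next
    case 4
    then have "emeasure M (space M) / 2 = \<infinity>"
      unfolding b_def by (auto simp: min_def top_unique split: if_splits)
    then have V: "emeasure M (space M) = \<infinity>"
      by (auto simp: ennreal_divide_eq_top_iff)
    have "a \<le> t / iso_profile M t * iso_profile M t"
      using assms cancel[OF assms(1) t_less] by simp
    also have "\<dots> \<le> iso_quotient M b * iso_profile M t"
      unfolding 4 using assms by (intro mult_right_mono iso_quotient_le_infinity V) auto
    finally show ?thesis .
  qed
  then show ?thesis by (simp add: b_def)
qed

text \<open>The support condition places the measure of every superlevel set in the range up to half
  the total, where \<open>le_iso_quotient_mult_profile\<close> supplies the hypothesis of the coarea
  inequality. Null superlevel sets are trivial.\<close>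

lemma weak_local_Poincare:
  assumes u: "u \<in> Lip" "\<And>x. 0 \<le> u x"
    and supp: "emeasure M {x. 0 < u x} < \<infinity>" "emeasure M {x. 0 < u x} \<le> emeasure M (space M) / 2"
    and A: "A \<in> sets M"
  shows "(\<integral>\<^sup>+x. indicator A x * ennreal (u x) \<partial>M)
    \<le> iso_quotient M (min (emeasure M A) (emeasure M (space M) / 2)) * (\<integral>\<^sup>+x. ennreal (grad_norm u x) \<partial>M)"
proof (rule coarea_isoperimetric[OF sets_borel u supp(1) A])
  fix t :: real assume "0 < t"
  have sets: "{x. s < u x} \<in> sets M" for s
    by (rule superlevel_set_measurable[OF sets_borel u supp(1)])
  have le: "emeasure M {x. t < u x} \<le> emeasure M {x. 0 < u x}"
    using \<open>0 < t\<close> by (intro emeasure_mono sets) auto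
  have sub: "emeasure M (A \<inter> {x. t < u x}) \<le> emeasure M {x. t < u x}"
    "emeasure M (A \<inter> {x. t < u x}) \<le> emeasure M A"
    using sets A by (auto intro: emeasure_mono)
  show "emeasure M (A \<inter> {x. t < u x})
    \<le> iso_quotient M (min (emeasure M A) (emeasure M (space M) / 2)) * iso_profile M (emeasure M {x. t < u x})"
  proof (cases "emeasure M {x. t < u x} = 0")
    case False
    then show ?thesis
      using le supp sub by (intro le_iso_quotient_mult_profile) (auto simp: zero_less_iff_neq_zero)
  qed (use sub in auto)
qed

end

section \<open>Local moment inequalities\<close>

text \<open>Half of \<open>F\<close> moves to the left-hand side. Finiteness is essential:
  \<open>F = \<infinity>\<close> satisfies the second assumption for every \<open>B\<close>.\<close>

lemma ennreal_absorb_half: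
  fixes F B :: ennreal
  assumes "F < \<infinity>" "F \<le> ennreal (1 / 2) * F + B"
  shows "F \<le> ennreal 2 * B"
proof (cases B)
  case (real b)
  obtain a where a: "F = ennreal a" "0 \<le> a" using assms(1) by (cases F) auto
  have "ennreal (1 / 2 * a + b) = ennreal (1 / 2 * a) + ennreal b"
    using a real by (intro ennreal_plus) auto
  also have "ennreal (1 / 2 * a) = ennreal (1 / 2) * ennreal a"
    using a by (intro ennreal_mult) auto
  finally have "ennreal a \<le> ennreal (1 / 2 * a + b)"
    using assms(2) unfolding a(1) real(2) by simp
  then have "a \<le> 1 / 2 * a + b" using a real by (subst (asm) ennreal_le_iff) auto
  then have "ennreal a \<le> ennreal (2 * b)" by (intro ennreal_leI) simp
  also have "\<dots> = ennreal 2 * ennreal b" using real by (intro ennreal_mult) auto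
  finally show ?thesis using a real by simp
qed (simp add: ennreal_mult_top)

lemma powr_add_le:
  fixes a b p :: real
  assumes "0 < p"
  shows "\<bar>a + b\<bar> powr p \<le> 2 powr p * (\<bar>a\<bar> powr p + \<bar>b\<bar> powr p)"
proof -
  have "\<bar>a + b\<bar> powr p \<le> (2 * max \<bar>a\<bar> \<bar>b\<bar>) powr p"
    using assms by (intro powr_mono2) auto
  also have "\<dots> = 2 powr p * max \<bar>a\<bar> \<bar>b\<bar> powr p" by (simp add: powr_mult)
  also have "max \<bar>a\<bar> \<bar>b\<bar> powr p \<le> \<bar>a\<bar> powr p + \<bar>b\<bar> powr p" by (simp add: max_def)
  finally show ?thesis by simp
qed

text \<open>The factor of \<open>b\<^sup>p\<close> in the splitting of \<open>p a\<^sup>p\<^sup>-\<^sup>1 b\<close>: when \<open>p b > \<delta> a\<close>, insert \<open>a < (p / \<delta>) b\<close>.\<close>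

definition young_const :: "real \<Rightarrow> real \<Rightarrow> real" where
  "young_const p \<delta> = p * (p / \<delta>) powr (p - 1)"

lemma young_const_pos: "1 < p \<Longrightarrow> 0 < \<delta> \<Longrightarrow> 0 < young_const p \<delta>"
  by (simp add: young_const_def)

lemma young_split:
  fixes a b p \<delta> :: real
  assumes "1 < p" "0 < \<delta>" "0 \<le> a" "0 \<le> b"
  shows "p * a powr (p - 1) * b \<le> \<delta> * a powr p + young_const p \<delta> * b powr p"
proof (cases "p * b \<le> \<delta> * a")
  case True
  have "p * a powr (p - 1) * b = a powr (p - 1) * (p * b)" by simp
  also have "\<dots> \<le> a powr (p - 1) * (\<delta> * a)" using True by (intro mult_left_mono) auto
  also have "\<dots> = \<delta> * a powr p" using assms powr_mult_base[of a "p - 1"] by (simp add: mult_ac)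
  finally show ?thesis using young_const_pos[of p \<delta>] assms by (simp add: add_increasing2)
next
  case False
  then have "a \<le> p / \<delta> * b" using assms by (simp add: field_simps)
  then have "a powr (p - 1) \<le> (p / \<delta> * b) powr (p - 1)" using assms by (intro powr_mono2) auto
  also have "\<dots> = (p / \<delta>) powr (p - 1) * b powr (p - 1)" using assms by (subst powr_mult) auto
  finally have "p * a powr (p - 1) * b \<le> p * ((p / \<delta>) powr (p - 1) * b powr (p - 1)) * b"
    using assms by (intro mult_right_mono mult_left_mono) auto
  also have "\<dots> = young_const p \<delta> * b powr p"
    using assms powr_mult_base[of b "p - 1"] by (simp add: young_const_def mult_ac)
  finally show ?thesis using assms by (simp add: add_increasing)
qed

section \<open>Truncation\<close>

definition truncate :: "real \<Rightarrow> real \<Rightarrow> real" where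
  "truncate N s = max (- N) (min s N)"

lemma truncate_contraction: "\<bar>truncate N s - truncate N t\<bar> \<le> \<bar>s - t\<bar>"
  by (auto simp: truncate_def max_def min_def)

lemma truncate_Lip: "f \<in> Lip \<Longrightarrow> (\<lambda>x. truncate N (f x)) \<in> Lip"
  by (erule Lip_compose_contraction) (rule truncate_contraction)

lemma abs_truncate_le: "0 \<le> N \<Longrightarrow> \<bar>truncate N s\<bar> \<le> N" "0 \<le> N \<Longrightarrow> \<bar>truncate N s\<bar> \<le> \<bar>s\<bar>"
  by (auto simp: truncate_def max_def min_def)

lemma truncate_pos_iff: "0 < N \<Longrightarrow> 0 < truncate N s \<longleftrightarrow> 0 < s" "0 < N \<Longrightarrow> truncate N s < 0 \<longleftrightarrow> s < 0"
  by (auto simp: truncate_def max_def min_def)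

lemma truncate_eq: "\<bar>s\<bar> \<le> N \<Longrightarrow> truncate N s = s"
  by (auto simp: truncate_def)

text \<open>Fatou's lemma: at every point the truncations eventually agree with \<open>f\<close>, so
  a bound uniform in the truncation level passes to \<open>f\<close>.\<close>

lemma nn_integral_truncate_le:
  assumes [measurable]: "f \<in> borel_measurable M" "A \<in> sets M"
    and le: "\<And>n. (\<integral>\<^sup>+x. indicator A x * ennreal (\<bar>truncate (real (Suc n)) (f x)\<bar> powr p) \<partial>M) \<le> B"
  shows "(\<integral>\<^sup>+x. indicator A x * ennreal (\<bar>f x\<bar> powr p) \<partial>M) \<le> B"
proof -
  have lim: "(\<lambda>n. indicator A x * ennreal (\<bar>truncate (real (Suc n)) (f x)\<bar> powr p))
      \<longlonglongrightarrow> indicator A x * ennreal (\<bar>f x\<bar> powr p)" for x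
  proof (rule tendsto_eventually)
    have "eventually (\<lambda>n. \<bar>f x\<bar> \<le> real n) sequentially"
      using filterlim_real_sequentially by (simp add: filterlim_at_top)
    then show "eventually (\<lambda>n. indicator A x * ennreal (\<bar>truncate (real (Suc n)) (f x)\<bar> powr p)
        = indicator A x * ennreal (\<bar>f x\<bar> powr p)) sequentially"
      by eventually_elim (subst truncate_eq, auto)
  qed
  have "(\<integral>\<^sup>+x. indicator A x * ennreal (\<bar>f x\<bar> powr p) \<partial>M)
      = (\<integral>\<^sup>+x. liminf (\<lambda>n. indicator A x * ennreal (\<bar>truncate (real (Suc n)) (f x)\<bar> powr p)) \<partial>M)"
    by (simp only: lim_imp_Liminf[OF sequentially_bot lim])
  also have "\<dots> \<le> liminf (\<lambda>n. \<integral>\<^sup>+x. indicator A x * ennreal (\<bar>truncate (real (Suc n)) (f x)\<bar> powr p) \<partial>M)"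
    unfolding truncate_def by (intro nn_integral_liminf) measurable
  also have "\<dots> \<le> B"
    by (intro Liminf_le always_eventually allI le) auto
  finally show ?thesis .
qed

text \<open>That is, 0 is a median; both sets are also required to have finite measure, which matters only if
  \<open>\<mu>(\<Omega>) = \<infinity>\<close>.\<close>

definition balanced :: "'a measure \<Rightarrow> ('a \<Rightarrow> real) \<Rightarrow> bool" where
  "balanced M f \<longleftrightarrow>
     emeasure M {x. 0 < f x} < \<infinity> \<and> emeasure M {x. 0 < f x} \<le> emeasure M (space M) / 2 \<and>
     emeasure M {x. f x < 0} < \<infinity> \<and> emeasure M {x. f x < 0} \<le> emeasure M (space M) / 2"

lemma balanced_truncate: "0 < N \<Longrightarrow> balanced M f \<Longrightarrow> balanced M (\<lambda>x. truncate N (f x))"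
  by (simp add: balanced_def truncate_pos_iff)

lemma max_powr_add: "max s 0 powr q + max (- s) 0 powr q = \<bar>s\<bar> powr (q::real)"
  by (auto simp: max_def)

section \<open>Moment bounds for functions with median zero\<close>

context isoperimetric_space
begin

lemma Lip_measurable_M: "f \<in> Lip \<Longrightarrow> f \<in> borel_measurable M"
  using Lip_measurable by (simp add: measurable_cong_sets[OF sets_borel refl])

lemma grad_norm_measurable_M: "f \<in> Lip \<Longrightarrow> grad_norm f \<in> borel_measurable M"
  using grad_norm_measurable by (simp add: measurable_cong_sets[OF sets_borel refl])

text \<open>\<open>weak_local_Poincare\<close> is applied to the \<open>p\<close>-th power of the
  positive part, which is Lipschitz because \<open>f\<close> is bounded and has the same positivity
  set as \<open>f\<close>.\<close>

lemma positive_part_moment_le: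
  assumes f: "f \<in> Lip" "\<And>x. \<bar>f x\<bar> \<le> B"
    and supp: "emeasure M {x. 0 < f x} < \<infinity>" "emeasure M {x. 0 < f x} \<le> emeasure M (space M) / 2"
    and A: "A \<in> sets M" and p: "1 < p"
    and K: "iso_quotient M (min (emeasure M A) (emeasure M (space M) / 2)) \<le> ennreal K"
  shows "(\<integral>\<^sup>+x. indicator A x * ennreal (max (f x) 0 powr p) \<partial>M)
    \<le> ennreal K * (\<integral>\<^sup>+x. ennreal (p * max (f x) 0 powr (p - 1) * grad_norm f x) \<partial>M)"
proof -
  \<comment> \<open>The chain rule is applied to the positive part of \<open>f\<close>, because its bound vanishes where \<open>f \<le> 0\<close>.\<close>
  define g where "g x = max (f x) 0" for x
  define u where "u x = max (g x) 0 powr p" for x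
  have contr: "\<bar>max s 0 - max t 0\<bar> \<le> \<bar>s - t\<bar>" for s t :: real by auto
  have g: "g \<in> Lip" unfolding g_def[abs_def] by (rule Lip_compose_contraction[OF f(1) contr])
  have "\<bar>g x\<bar> \<le> B" for x using f(2)[of x] by (auto simp: g_def)
  then have u: "u \<in> Lip" unfolding u_def[abs_def] by (rule posp_powr_Lip[OF g p])
  have u_nonneg: "0 \<le> u x" for x by (simp add: u_def)
  have u_pos: "{x. 0 < u x} = {x. 0 < f x}"
    by (auto simp: u_def g_def max_def)
  have grad: "grad_norm u x \<le> p * max (f x) 0 powr (p - 1) * grad_norm f x" for x
  proof -
    have "grad_norm u x \<le> p * \<bar>g x\<bar> powr (p - 1) * grad_norm g x"
      unfolding u_def[abs_def] by (rule grad_norm_posp_powr[OF g p])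
    also have "\<dots> \<le> p * \<bar>g x\<bar> powr (p - 1) * grad_norm f x"
      using grad_norm_compose_contraction[OF f(1) contr] p unfolding g_def[abs_def]
      by (intro mult_left_mono) auto
    finally show ?thesis by (simp add: g_def)
  qed
  have "(\<integral>\<^sup>+x. indicator A x * ennreal (max (f x) 0 powr p) \<partial>M) = (\<integral>\<^sup>+x. indicator A x * ennreal (u x) \<partial>M)"
    by (simp add: u_def g_def)
  also have "\<dots> \<le> iso_quotient M (min (emeasure M A) (emeasure M (space M) / 2)) * (\<integral>\<^sup>+x. ennreal (grad_norm u x) \<partial>M)"
    using supp A by (intro weak_local_Poincare u u_nonneg) (simp_all add: u_pos)
  also have "\<dots> \<le> ennreal K * (\<integral>\<^sup>+x. ennreal (p * max (f x) 0 powr (p - 1) * grad_norm f x) \<partial>M)"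
    by (intro mult_mono K nn_integral_mono ennreal_leI grad) auto
  finally show ?thesis .
qed

text \<open>The estimates for \<open>f\<close> and \<open>- f\<close> add up, since at each point at
  most one of the two positive parts is nonzero. Young's inequality with
  \<open>b = K * grad_norm f x\<close> then separates \<open>f\<close> from its gradient.\<close>

lemma balanced_local_moment_bounded:
  assumes f: "f \<in> Lip" "\<And>x. \<bar>f x\<bar> \<le> B" "balanced M f"
    and A: "A \<in> sets M" and p: "1 < p" and "0 < \<delta>" "0 \<le> K"
    and K: "iso_quotient M (min (emeasure M A) (emeasure M (space M) / 2)) \<le> ennreal K"
  shows "(\<integral>\<^sup>+x. indicator A x * ennreal (\<bar>f x\<bar> powr p) \<partial>M)
    \<le> ennreal \<delta> * (\<integral>\<^sup>+x. ennreal (\<bar>f x\<bar> powr p) \<partial>M)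
      + ennreal (young_const p \<delta> * K powr p) * (\<integral>\<^sup>+x. ennreal (\<bar>grad_norm f x\<bar> powr p) \<partial>M)"
proof -
  have neg: "(\<lambda>x. - f x) \<in> Lip"
    by (rule Lip_compose_contraction[OF f(1)]) auto
  have [measurable]: "f \<in> borel_measurable M" "grad_norm f \<in> borel_measurable M" "A \<in> sets M"
    using f A Lip_measurable_M grad_norm_measurable_M by auto
  have g: "0 \<le> grad_norm f x" for x by (rule grad_norm_nonneg)
  have "(\<integral>\<^sup>+x. indicator A x * ennreal (\<bar>f x\<bar> powr p) \<partial>M)
    = (\<integral>\<^sup>+x. indicator A x * ennreal (max (f x) 0 powr p) \<partial>M)
      + (\<integral>\<^sup>+x. indicator A x * ennreal (max (- f x) 0 powr p) \<partial>M)"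
    unfolding max_powr_add[of _ p, symmetric] by (simp add: ennreal_plus distrib_left nn_integral_add)
  also have "\<dots> \<le> ennreal K * (\<integral>\<^sup>+x. ennreal (p * max (f x) 0 powr (p - 1) * grad_norm f x) \<partial>M)
      + ennreal K * (\<integral>\<^sup>+x. ennreal (p * max (- f x) 0 powr (p - 1) * grad_norm f x) \<partial>M)"
    using f positive_part_moment_le[OF f(1,2) _ _ A p K] positive_part_moment_le[OF neg _ _ _ A p K, of B]
    by (intro add_mono) (auto simp: balanced_def grad_norm_uminus)
  also have "\<dots> = ennreal K * (\<integral>\<^sup>+x. ennreal (p * \<bar>f x\<bar> powr (p - 1) * grad_norm f x) \<partial>M)"
    using p g unfolding max_powr_add[of _ "p - 1", symmetric]
    by (simp add: ennreal_plus distrib_left distrib_right nn_integral_add)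
  also have "\<dots> = (\<integral>\<^sup>+x. ennreal (p * \<bar>f x\<bar> powr (p - 1) * (K * grad_norm f x)) \<partial>M)"
    using p g \<open>0 \<le> K\<close>
    by (subst nn_integral_cmult[symmetric]) (simp_all add: mult_ac flip: ennreal_mult)
  also have "\<dots> \<le> (\<integral>\<^sup>+x. ennreal (\<delta> * \<bar>f x\<bar> powr p + young_const p \<delta> * K powr p * \<bar>grad_norm f x\<bar> powr p) \<partial>M)"
  proof (intro nn_integral_mono ennreal_leI)
    fix x
    show "p * \<bar>f x\<bar> powr (p - 1) * (K * grad_norm f x)
        \<le> \<delta> * \<bar>f x\<bar> powr p + young_const p \<delta> * K powr p * \<bar>grad_norm f x\<bar> powr p"
      using young_split[OF p \<open>0 < \<delta>\<close>, of "\<bar>f x\<bar>" "K * grad_norm f x"] g[of x] \<open>0 \<le> K\<close>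
      by (simp add: powr_mult mult.assoc)
  qed
  also have "\<dots> = ennreal \<delta> * (\<integral>\<^sup>+x. ennreal (\<bar>f x\<bar> powr p) \<partial>M)
      + ennreal (young_const p \<delta> * K powr p) * (\<integral>\<^sup>+x. ennreal (\<bar>grad_norm f x\<bar> powr p) \<partial>M)"
    using young_const_pos[OF p \<open>0 < \<delta>\<close>] \<open>0 < \<delta>\<close>
    by (simp add: ennreal_plus ennreal_mult nn_integral_add nn_integral_cmult)
  finally show ?thesis .
qed

lemma grad_norm_truncate_moment_le:
  assumes "f \<in> Lip" "0 \<le> p"
  shows "(\<integral>\<^sup>+x. ennreal (\<bar>grad_norm (\<lambda>x. truncate N (f x)) x\<bar> powr p) \<partial>M)
    \<le> (\<integral>\<^sup>+x. ennreal (\<bar>grad_norm f x\<bar> powr p) \<partial>M)"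
  using grad_norm_compose_contraction[OF assms(1) truncate_contraction] assms(2)
  by (intro nn_integral_mono ennreal_leI powr_mono2) (auto simp: grad_norm_nonneg)

text \<open>Truncation preserves signs, hence balance, and increases neither \<open>|f|\<close> nor
  the gradient, so the bounded case applies with a right-hand side free of the truncation
  level.\<close>

lemma balanced_local_moment:
  assumes f: "f \<in> Lip" "balanced M f"
    and A: "A \<in> sets M" and p: "1 < p" and "0 < \<delta>" "0 \<le> K"
    and K: "iso_quotient M (min (emeasure M A) (emeasure M (space M) / 2)) \<le> ennreal K"
  shows "(\<integral>\<^sup>+x. indicator A x * ennreal (\<bar>f x\<bar> powr p) \<partial>M)
    \<le> ennreal \<delta> * (\<integral>\<^sup>+x. ennreal (\<bar>f x\<bar> powr p) \<partial>M)
      + ennreal (young_const p \<delta> * K powr p) * (\<integral>\<^sup>+x. ennreal (\<bar>grad_norm f x\<bar> powr p) \<partial>M)"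
proof (rule nn_integral_truncate_le[OF Lip_measurable_M[OF f(1)] A])
  fix n
  let ?g = "\<lambda>x. truncate (real (Suc n)) (f x)"
  have "(\<integral>\<^sup>+x. indicator A x * ennreal (\<bar>?g x\<bar> powr p) \<partial>M)
    \<le> ennreal \<delta> * (\<integral>\<^sup>+x. ennreal (\<bar>?g x\<bar> powr p) \<partial>M)
      + ennreal (young_const p \<delta> * K powr p) * (\<integral>\<^sup>+x. ennreal (\<bar>grad_norm ?g x\<bar> powr p) \<partial>M)"
    using assms(5,6)
    by (intro balanced_local_moment_bounded[OF truncate_Lip[OF f(1)] abs_truncate_le(1) balanced_truncate[OF _ f(2)] A p _ _ K])
      auto
  also have "\<dots> \<le> ennreal \<delta> * (\<integral>\<^sup>+x. ennreal (\<bar>f x\<bar> powr p) \<partial>M)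
      + ennreal (young_const p \<delta> * K powr p) * (\<integral>\<^sup>+x. ennreal (\<bar>grad_norm f x\<bar> powr p) \<partial>M)"
    using p by (intro add_mono mult_left_mono nn_integral_mono ennreal_leI powr_mono2 grad_norm_truncate_moment_le f)
      (auto simp: abs_truncate_le)
  finally show "(\<integral>\<^sup>+x. indicator A x * ennreal (\<bar>?g x\<bar> powr p) \<partial>M) \<le> \<dots>" .
qed

text \<open>The moment is split over \<open>A\<close> and its complement, and the local bound with
  \<open>\<delta> = 1 / 2\<close> is absorbed. The moment of \<open>f\<close> may be infinite, so
  the absorption is carried out for truncations.\<close>

lemma balanced_moment:
  assumes f: "f \<in> Lip" "balanced M f"
    and A: "A \<in> sets M" and p: "1 < p" and "0 \<le> K"
    and K: "iso_quotient M (min (emeasure M A) (emeasure M (space M) / 2)) \<le> ennreal K"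
  shows "(\<integral>\<^sup>+x. ennreal (\<bar>f x\<bar> powr p) \<partial>M)
    \<le> ennreal 2 * (ennreal (young_const p (1 / 2) * K powr p) * (\<integral>\<^sup>+x. ennreal (\<bar>grad_norm f x\<bar> powr p) \<partial>M)
        + (\<integral>\<^sup>+x. indicator (- A) x * ennreal (\<bar>f x\<bar> powr p) \<partial>M))"
    (is "_ \<le> ennreal 2 * ?B")
proof -
  have UNIV: "UNIV \<in> sets M" by (simp add: sets_borel)
  have space: "space M = UNIV" using sets_eq_imp_space_eq[OF sets_borel] by simp
  have [measurable]: "f \<in> borel_measurable M" "A \<in> sets M"
    using f A Lip_measurable_M by auto
  have nA[measurable]: "- A \<in> sets M" using sets.compl_sets[OF A] by (simp add: space Compl_eq_Diff_UNIV)
  have "(\<integral>\<^sup>+x. indicator UNIV x * ennreal (\<bar>f x\<bar> powr p) \<partial>M) \<le> ennreal 2 * ?B"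
  proof (rule nn_integral_truncate_le[OF Lip_measurable_M[OF f(1)] UNIV])
    fix n :: nat
    define N where "N = real (Suc n)"
    have N: "0 < N" by (simp add: N_def)
    let ?g = "\<lambda>x. truncate (N) (f x)"
    let ?S = "{x. 0 < f x} \<union> {x. f x < 0}"
    have S: "{x. 0 < f x} \<in> sets M" "{x. f x < 0} \<in> sets M"
      using measurable_sets[of f M borel "{0<..}"] measurable_sets[of f M borel "{..<0}"]
      by (auto simp: space vimage_def)
    have g_meas[measurable]: "?g \<in> borel_measurable M" unfolding truncate_def by measurable
    \<comment> \<open>A truncation is bounded by \<open>N\<close> and vanishes off a set of finite
      measure, so its moment is finite, as absorption requires.\<close>
    have "(\<integral>\<^sup>+x. ennreal (\<bar>?g x\<bar> powr p) \<partial>M) \<le> (\<integral>\<^sup>+x. ennreal (N powr p) * indicator ?S x \<partial>M)"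
    proof (intro nn_integral_mono)
      fix x
      show "ennreal (\<bar>?g x\<bar> powr p) \<le> ennreal (N powr p) * indicator ?S x"
      proof (cases "f x = 0")
        case False
        then show ?thesis using p N
          by (auto simp: indicator_def intro!: ennreal_leI powr_mono2 abs_truncate_le)
      qed (use N in \<open>simp add: truncate_def\<close>)
    qed
    also have "\<dots> = ennreal (N powr p) * emeasure M ?S"
      using S by (intro nn_integral_cmult_indicator) auto
    also have "\<dots> < \<infinity>"
      using f(2) emeasure_subadditive[OF S]
      by (auto simp: balanced_def ennreal_mult_less_top intro: le_less_trans)
    finally have fin: "(\<integral>\<^sup>+x. ennreal (\<bar>?g x\<bar> powr p) \<partial>M) < \<infinity>" .
    have "(\<integral>\<^sup>+x. ennreal (\<bar>?g x\<bar> powr p) \<partial>M)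
      = (\<integral>\<^sup>+x. indicator A x * ennreal (\<bar>?g x\<bar> powr p) \<partial>M) + (\<integral>\<^sup>+x. indicator (- A) x * ennreal (\<bar>?g x\<bar> powr p) \<partial>M)"
      by (subst nn_integral_add[symmetric]) (auto intro!: nn_integral_cong simp: indicator_def)
    also have "\<dots> \<le> (ennreal (1 / 2) * (\<integral>\<^sup>+x. ennreal (\<bar>?g x\<bar> powr p) \<partial>M)
      + ennreal (young_const p (1 / 2) * K powr p) * (\<integral>\<^sup>+x. ennreal (\<bar>grad_norm ?g x\<bar> powr p) \<partial>M))
      + (\<integral>\<^sup>+x. indicator (- A) x * ennreal (\<bar>?g x\<bar> powr p) \<partial>M)"
      using assms(5) N
      by (intro add_right_mono balanced_local_moment[OF truncate_Lip[OF f(1)] balanced_truncate[OF _ f(2)] A p _ _ K])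
        auto
    also have "\<dots> \<le> (ennreal (1 / 2) * (\<integral>\<^sup>+x. ennreal (\<bar>?g x\<bar> powr p) \<partial>M)
      + ennreal (young_const p (1 / 2) * K powr p) * (\<integral>\<^sup>+x. ennreal (\<bar>grad_norm f x\<bar> powr p) \<partial>M))
      + (\<integral>\<^sup>+x. indicator (- A) x * ennreal (\<bar>f x\<bar> powr p) \<partial>M)"
      using p N by (intro add_mono mult_left_mono nn_integral_mono ennreal_leI powr_mono2 grad_norm_truncate_moment_le f order_refl)
        (auto simp: abs_truncate_le)
    finally have "(\<integral>\<^sup>+x. ennreal (\<bar>?g x\<bar> powr p) \<partial>M)
      \<le> ennreal (1 / 2) * (\<integral>\<^sup>+x. ennreal (\<bar>?g x\<bar> powr p) \<partial>M) + ?B" by (simp add: add.assoc)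
    from ennreal_absorb_half[OF fin this] show "(\<integral>\<^sup>+x. indicator UNIV x * ennreal (\<bar>truncate (real (Suc n)) (f x)\<bar> powr p) \<partial>M) \<le> ennreal 2 * ?B"
      unfolding N_def by (simp only: indicator_UNIV mult_1)
  qed
  then show ?thesis by simp
qed

end

section \<open>The weighted inequality\<close>

lemma powr_add_subadditive:
  fixes x y q :: real
  assumes "0 \<le> x" "0 \<le> y" "0 < q" "q \<le> 1"
  shows "(x + y) powr q \<le> x powr q + y powr q"
proof (cases "x + y = 0")
  case False
  then have s: "0 < x + y" using assms by linarith
  \<comment> \<open>After division by \<open>x + y\<close> both terms lie in the unit interval,
    where raising to the power \<open>q \<le> 1\<close> does not decrease them.\<close>
  have le: "t \<le> t powr q" if "0 \<le> t" "t \<le> 1" for t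
    using powr_mono'[of q 1 t] that assms by simp
  have "(x + y) powr q * 1 \<le> (x + y) powr q * ((x / (x + y)) powr q + (y / (x + y)) powr q)"
  proof (intro mult_left_mono)
    have "1 = x / (x + y) + y / (x + y)" using s by (simp flip: add_divide_distrib)
    also have "\<dots> \<le> (x / (x + y)) powr q + (y / (x + y)) powr q"
      using assms s by (intro add_mono le) auto
    finally show "1 \<le> (x / (x + y)) powr q + (y / (x + y)) powr q" .
  qed simp
  also have "\<dots> = x powr q + y powr q"
    using s assms by (simp add: powr_divide distrib_left)
  finally show ?thesis by simp
qed (use assms in simp)

text \<open>Subadditivity of the power \<open>1 / p\<close> splits the root of the sum. Infinite
  moments on the right are trivial because \<open>a\<close> and \<open>b\<close> are
  positive.\<close>

lemma Lp_norm_le_if_moment_le: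
  assumes p: "1 < p" and ab: "0 < a" "0 < b"
    and le: "(\<integral>\<^sup>+x. ennreal (\<bar>f x\<bar> powr p) \<partial>M) \<le> ennreal (a powr p) * (\<integral>\<^sup>+x. ennreal (\<bar>g x\<bar> powr p) \<partial>M)
      + ennreal (b powr p) * (\<integral>\<^sup>+x. ennreal (\<bar>k x\<bar> powr p) \<partial>M)"
  shows "Lp_norm M p f \<le> ennreal a * Lp_norm M p g + ennreal b * Lp_norm M p k"
proof -
  define F where "F = (\<integral>\<^sup>+x. ennreal (\<bar>f x\<bar> powr p) \<partial>M)"
  define G where "G = (\<integral>\<^sup>+x. ennreal (\<bar>g x\<bar> powr p) \<partial>M)"
  define K where "K = (\<integral>\<^sup>+x. ennreal (\<bar>k x\<bar> powr p) \<partial>M)"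
  show ?thesis
  proof (cases "G = \<infinity> \<or> K = \<infinity>")
    case True
    then have "ennreal a * Lp_norm M p g + ennreal b * Lp_norm M p k = \<infinity>"
      using ab by (auto simp: Lp_norm_def G_def K_def ennreal_mult_top)
    then show ?thesis by (simp only: infinity_ennreal_def top_greatest)
  next
    case False
    then obtain G' K' where GK: "G = ennreal G'" "0 \<le> G'" "K = ennreal K'" "0 \<le> K'"
      by (cases G; cases K) auto
    have "F \<le> ennreal (a powr p * G' + b powr p * K')"
      using le GK by (simp add: F_def[symmetric] G_def[symmetric] K_def[symmetric] ennreal_mult ennreal_plus)
    then obtain F' where F: "F = ennreal F'" "0 \<le> F'" "F' \<le> a powr p * G' + b powr p * K'"
      using GK by (cases F) (auto simp: top_unique ennreal_le_iff simp flip: ennreal_plus)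
    have "F' powr (1 / p) \<le> (a powr p * G' + b powr p * K') powr (1 / p)"
      using F p by (intro powr_mono2) auto
    also have "\<dots> \<le> (a powr p * G') powr (1 / p) + (b powr p * K') powr (1 / p)"
      using GK p by (intro powr_add_subadditive) auto
    also have "\<dots> = a * G' powr (1 / p) + b * K' powr (1 / p)"
      using GK p ab by (simp add: powr_mult powr_powr)
    finally have "ennreal (F' powr (1 / p)) \<le> ennreal (a * G' powr (1 / p) + b * K' powr (1 / p))"
      by (rule ennreal_leI)
    also have "\<dots> = ennreal a * ennreal (G' powr (1 / p)) + ennreal b * ennreal (K' powr (1 / p))"
      using ab by (subst ennreal_plus) (auto simp: ennreal_mult)
    finally show ?thesis
      unfolding Lp_norm_def F_def[symmetric] G_def[symmetric] K_def[symmetric] Let_def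
      using F GK by simp
  qed
qed

text \<open>The factor 2 left over from absorption is at most \<open>2 powr p\<close>, which
  accounts for the constant 2 at the weighted norm; in the gradient term it is taken into
  \<open>D\<close>.\<close>

lemma Lp_norm_interpolation_if_moment_le:
  assumes p: "1 < p" and r: "0 < r" and D: "0 < D" and c: "0 \<le> c" "2 * c \<le> D powr p"
    and le: "(\<integral>\<^sup>+x. ennreal (\<bar>f x\<bar> powr p) \<partial>M)
      \<le> ennreal 2 * (ennreal (c * r powr p) * (\<integral>\<^sup>+x. ennreal (\<bar>g x\<bar> powr p) \<partial>M)
        + ennreal ((r powr (- \<alpha>)) powr p) * (\<integral>\<^sup>+x. ennreal (\<bar>k x\<bar> powr p) \<partial>M))"
  shows "Lp_norm M p f \<le> ennreal (D * r) * Lp_norm M p g + ennreal (2 * r powr (- \<alpha>)) * Lp_norm M p k"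
proof (rule Lp_norm_le_if_moment_le[OF p])
  define G where "G = (\<integral>\<^sup>+x. ennreal (\<bar>g x\<bar> powr p) \<partial>M)"
  define K where "K = (\<integral>\<^sup>+x. ennreal (\<bar>k x\<bar> powr p) \<partial>M)"
  have two: "2 \<le> 2 powr p" using p powr_mono[of 1 p 2] by simp
  have "(\<integral>\<^sup>+x. ennreal (\<bar>f x\<bar> powr p) \<partial>M)
      \<le> ennreal 2 * (ennreal (c * r powr p) * G + ennreal ((r powr (- \<alpha>)) powr p) * K)"
    using le by (simp only: G_def K_def)
  also have "ennreal 2 * (ennreal (c * r powr p) * G + ennreal ((r powr (- \<alpha>)) powr p) * K)
      = ennreal (2 * c * r powr p) * G + ennreal (2 * (r powr (- \<alpha>)) powr p) * K"
  proof -
    have "ennreal (2 * c * r powr p) = ennreal 2 * ennreal (c * r powr p)"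
      using c by (subst ennreal_mult[symmetric]) (auto simp: mult.assoc)
    moreover have "ennreal (2 * (r powr (- \<alpha>)) powr p) = ennreal 2 * ennreal ((r powr (- \<alpha>)) powr p)"
      by (intro ennreal_mult) auto
    ultimately show ?thesis by (simp only: distrib_left mult.assoc)
  qed
  also have "\<dots> \<le> ennreal ((D * r) powr p) * G + ennreal ((2 * r powr (- \<alpha>)) powr p) * K"
    using c two D r by (intro add_mono mult_right_mono ennreal_leI) (auto simp: powr_mult intro!: mult_right_mono)
  finally show "(\<integral>\<^sup>+x. ennreal (\<bar>f x\<bar> powr p) \<partial>M) \<le> ennreal ((D * r) powr p) * (\<integral>\<^sup>+x. ennreal (\<bar>g x\<bar> powr p) \<partial>M)
      + ennreal ((2 * r powr (- \<alpha>)) powr p) * (\<integral>\<^sup>+x. ennreal (\<bar>k x\<bar> powr p) \<partial>M)"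
    by (simp only: G_def K_def)
qed (use D r in auto)

text \<open>Off the sublevel set one has \<open>w x > r\<close>, so the factor
  \<open>r powr (- \<alpha>) * w x powr \<alpha>\<close> is at least 1.\<close>

lemma weight_tail_moment_le:
  assumes [measurable]: "w \<in> borel_measurable M" "f \<in> borel_measurable M"
    and r: "0 < r" and \<alpha>: "0 < \<alpha>" and p: "0 < p"
  shows "(\<integral>\<^sup>+x. indicator (- {x. w x \<le> r}) x * ennreal (\<bar>f x\<bar> powr p) \<partial>M)
    \<le> ennreal ((r powr (- \<alpha>)) powr p) * (\<integral>\<^sup>+x. ennreal (\<bar>w x powr \<alpha> * \<bar>f x\<bar>\<bar> powr p) \<partial>M)"
proof -
  have "(\<integral>\<^sup>+x. indicator (- {x. w x \<le> r}) x * ennreal (\<bar>f x\<bar> powr p) \<partial>M)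
      \<le> (\<integral>\<^sup>+x. ennreal ((r powr (- \<alpha>)) powr p) * ennreal (\<bar>w x powr \<alpha> * \<bar>f x\<bar>\<bar> powr p) \<partial>M)"
  proof (intro nn_integral_mono)
    fix x
    show "indicator (- {x. w x \<le> r}) x * ennreal (\<bar>f x\<bar> powr p)
      \<le> ennreal ((r powr (- \<alpha>)) powr p) * ennreal (\<bar>w x powr \<alpha> * \<bar>f x\<bar>\<bar> powr p)"
    proof (cases "w x \<le> r")
      case False
      then have "r powr \<alpha> \<le> w x powr \<alpha>" using r \<alpha> by (intro powr_mono2) auto
      then have "1 \<le> r powr (- \<alpha>) * w x powr \<alpha>"
        using r by (simp add: powr_minus field_simps)
      then have "1 * \<bar>f x\<bar> \<le> r powr (- \<alpha>) * w x powr \<alpha> * \<bar>f x\<bar>"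
        by (intro mult_right_mono) auto
      then have "\<bar>f x\<bar> powr p \<le> (r powr (- \<alpha>) * (w x powr \<alpha> * \<bar>f x\<bar>)) powr p"
        using p by (intro powr_mono2) (auto simp: mult.assoc)
      also have "\<dots> = (r powr (- \<alpha>)) powr p * \<bar>w x powr \<alpha> * \<bar>f x\<bar>\<bar> powr p"
        by (subst powr_mult) (auto simp: abs_mult)
      finally show ?thesis using False by (simp add: ennreal_leI flip: ennreal_mult)
    qed simp
  qed
  also have "\<dots> = ennreal ((r powr (- \<alpha>)) powr p) * (\<integral>\<^sup>+x. ennreal (\<bar>w x powr \<alpha> * \<bar>f x\<bar>\<bar> powr p) \<partial>M)"
    by (rule nn_integral_cmult) measurable
  finally show ?thesis .
qed

context isoperimetric_space
begin

lemma space_eq_UNIV: "space M = UNIV"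
  using sets_eq_imp_space_eq[OF sets_borel] by simp

lemma weight_sublevel_bound:
  assumes "isoperimetric_weight M w"
  obtains C where "0 < C" "\<And>r. 0 < r \<Longrightarrow>
    iso_quotient M (min (emeasure M {x. w x \<le> r}) (emeasure M (space M) / 2)) \<le> ennreal (C * r)"
  using assms unfolding isoperimetric_weight_def by (auto simp: space_eq_UNIV)

lemma weight_sublevel_sets:
  assumes "isoperimetric_weight M w"
  shows "{x. w x \<le> r} \<in> sets M"
proof -
  have [measurable]: "w \<in> borel_measurable M" using assms by (simp add: isoperimetric_weight_def)
  have "{x \<in> space M. w x \<le> r} \<in> sets M" by measurable
  then show ?thesis by (simp add: space_eq_UNIV)
qed

text \<open>\<open>balanced_moment\<close> with \<open>A = {w \<le> r}\<close> and
  \<open>K = C * r\<close>, followed by the tail bound on the complement.\<close>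

lemma balanced_weighted_moment:
  assumes w: "isoperimetric_weight M w" and f: "f \<in> Lip" "balanced M f"
    and C: "0 < C" "iso_quotient M (min (emeasure M {x. w x \<le> r}) (emeasure M (space M) / 2)) \<le> ennreal (C * r)"
    and p: "1 < p" and r: "0 < r" and \<alpha>: "0 < \<alpha>"
  shows "(\<integral>\<^sup>+x. ennreal (\<bar>f x\<bar> powr p) \<partial>M)
    \<le> ennreal 2 * (ennreal (young_const p (1 / 2) * C powr p * r powr p) * (\<integral>\<^sup>+x. ennreal (\<bar>grad_norm f x\<bar> powr p) \<partial>M)
      + ennreal ((r powr (- \<alpha>)) powr p) * (\<integral>\<^sup>+x. ennreal (\<bar>w x powr \<alpha> * \<bar>f x\<bar>\<bar> powr p) \<partial>M))"
proof -
  have "w \<in> borel_measurable M" using w by (simp add: isoperimetric_weight_def)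
  note tail = weight_tail_moment_le[OF this Lip_measurable_M[OF f(1)] r \<alpha>, of p]
  have "(\<integral>\<^sup>+x. ennreal (\<bar>f x\<bar> powr p) \<partial>M)
    \<le> ennreal 2 * (ennreal (young_const p (1 / 2) * (C * r) powr p) * (\<integral>\<^sup>+x. ennreal (\<bar>grad_norm f x\<bar> powr p) \<partial>M)
      + (\<integral>\<^sup>+x. indicator (- {x. w x \<le> r}) x * ennreal (\<bar>f x\<bar> powr p) \<partial>M))"
    using C r by (intro balanced_moment[OF f weight_sublevel_sets[OF w] p]) auto
  also have "\<dots> \<le> ennreal 2 * (ennreal (young_const p (1 / 2) * (C * r) powr p) * (\<integral>\<^sup>+x. ennreal (\<bar>grad_norm f x\<bar> powr p) \<partial>M)
      + ennreal ((r powr (- \<alpha>)) powr p) * (\<integral>\<^sup>+x. ennreal (\<bar>w x powr \<alpha> * \<bar>f x\<bar>\<bar> powr p) \<partial>M))"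
    using p by (intro mult_left_mono add_left_mono tail) auto
  also have "(C * r) powr p = C powr p * r powr p" using C r by (simp add: powr_mult)
  finally show ?thesis by (simp only: mult.assoc)
qed

text \<open>The closed support is compact, hence of finite measure, while half of an infinite total
  is infinite.\<close>

lemma balanced_if_compact_support:
  assumes V: "emeasure M (space M) = \<infinity>" and f: "f \<in> Lip0"
  shows "balanced M f"
proof -
  have K: "compact (closure {x. f x \<noteq> 0})" "closure {x. f x \<noteq> 0} \<in> sets M"
    using f by (auto simp: Lip0_def sets_borel)
  have "emeasure M {x. 0 < f x} \<le> emeasure M (closure {x. f x \<noteq> 0})"
    "emeasure M {x. f x < 0} \<le> emeasure M (closure {x. f x \<noteq> 0})"
    using closure_subset[of "{x. f x \<noteq> 0}"] by (auto intro!: emeasure_mono K)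
  with compact_finite[OF K(1)] V show ?thesis
    unfolding balanced_def by (auto simp: ennreal_top_divide intro: le_less_trans)
qed

lemma level_sets_measurable:
  fixes g :: "'a \<Rightarrow> real"
  assumes "g \<in> borel_measurable M"
  shows "{x. g x < c} \<in> sets M" "{x. c < g x} \<in> sets M" "{x. g x \<le> c} \<in> sets M" "{x. c \<le> g x} \<in> sets M"
  using measurable_sets[OF assms, of "{..<c}"] measurable_sets[OF assms, of "{c<..}"]
    measurable_sets[OF assms, of "{..c}"] measurable_sets[OF assms, of "{c..}"]
  by (auto simp: vimage_def space_eq_UNIV)

text \<open>Used with \<open>c\<close> equal to \<open>m\<close> or \<open>- m\<close>, to pass
  between \<open>f\<close> and \<open>f - m\<close> in either direction.\<close>

lemma moment_add_const_le:
  assumes f: "f \<in> borel_measurable M" and A: "A \<in> sets M" and p: "0 < p"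
  shows "(\<integral>\<^sup>+x. indicator A x * ennreal (\<bar>f x + c\<bar> powr p) \<partial>M)
    \<le> ennreal (2 powr p) * ((\<integral>\<^sup>+x. indicator A x * ennreal (\<bar>f x\<bar> powr p) \<partial>M) + ennreal (\<bar>c\<bar> powr p) * emeasure M A)"
proof -
  note [measurable] = f A
  have "(\<integral>\<^sup>+x. indicator A x * ennreal (\<bar>f x + c\<bar> powr p) \<partial>M)
      \<le> (\<integral>\<^sup>+x. ennreal (2 powr p) * (indicator A x * ennreal (\<bar>f x\<bar> powr p) + ennreal (\<bar>c\<bar> powr p) * indicator A x) \<partial>M)"
  proof (intro nn_integral_mono)
    fix x
    have "ennreal (\<bar>f x + c\<bar> powr p) \<le> ennreal (2 powr p) * (ennreal (\<bar>f x\<bar> powr p) + ennreal (\<bar>c\<bar> powr p))"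
      using powr_add_le[OF p, of "f x" c] by (simp add: ennreal_leI flip: ennreal_mult ennreal_plus)
    then show "indicator A x * ennreal (\<bar>f x + c\<bar> powr p)
      \<le> ennreal (2 powr p) * (indicator A x * ennreal (\<bar>f x\<bar> powr p) + ennreal (\<bar>c\<bar> powr p) * indicator A x)"
      by (cases "x \<in> A") auto
  qed
  also have "\<dots> = ennreal (2 powr p) * ((\<integral>\<^sup>+x. indicator A x * ennreal (\<bar>f x\<bar> powr p) \<partial>M) + ennreal (\<bar>c\<bar> powr p) * emeasure M A)"
    by (simp add: nn_integral_cmult nn_integral_add nn_integral_cmult_indicator)
  finally show ?thesis .
qed

section \<open>Finite total measure: medians and mean-zero functions\<close>

context
  assumes finite_total: "emeasure M (space M) < \<infinity>"
begin

interpretation finite_measure M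
  by (rule finite_measureI) (use finite_total in auto)

lemma half_total: "emeasure M (space M) / 2 = ennreal (measure M UNIV / 2)"
  by (simp add: emeasure_eq_measure space_eq_UNIV ennreal_divide_numeral)

lemma balanced_iff_measure:
  "balanced M f \<longleftrightarrow> measure M {x. 0 < f x} \<le> measure M UNIV / 2 \<and> measure M {x. f x < 0} \<le> measure M UNIV / 2"
  unfolding balanced_def half_total by (auto simp: emeasure_eq_measure)

lemma balanced_if_median:
  assumes "f \<in> Lip" "is_median M f 0"
  shows "balanced M f"
proof -
  note sets = level_sets_measurable[OF Lip_measurable_M[OF assms(1)]]
  have "measure M UNIV / 2 \<le> measure M {x. 0 \<le> f x}" "measure M UNIV / 2 \<le> measure M {x. f x \<le> 0}"
    using assms(2) unfolding is_median_def half_total by (auto simp: emeasure_eq_measure space_eq_UNIV)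
  moreover have "measure M {x. f x < 0} = measure M UNIV - measure M {x. 0 \<le> f x}"
    using finite_measure_compl[OF sets(4)[of 0]] by (simp add: space_eq_UNIV Collect_neg_eq[symmetric] Compl_eq_Diff_UNIV[symmetric] not_le)
  moreover have "measure M {x. 0 < f x} = measure M UNIV - measure M {x. f x \<le> 0}"
    using finite_measure_compl[OF sets(3)[of 0]] by (simp add: space_eq_UNIV Collect_neg_eq[symmetric] Compl_eq_Diff_UNIV[symmetric] not_le)
  ultimately show ?thesis by (simp add: balanced_iff_measure)
qed

text \<open>Existence of a median: \<open>m\<close> is the infimum of the levels \<open>t\<close>
  for which \<open>{f > t}\<close> has at most half the mass, and continuity of the measure along
  levels approaching \<open>m\<close> gives both inequalities.\<close>

lemma exists_balancing_constant:
  assumes "f \<in> Lip"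
  shows "\<exists>m. balanced M (\<lambda>x. f x - m)"
\<comment> \<open>For zero total mass every level qualifies and the infimum below would be
  meaningless.\<close>
proof (cases "measure M UNIV = 0")
  case True
  then have "measure M A = 0" for A
    using bounded_measure[of A] measure_nonneg[of M A] by (simp add: space_eq_UNIV)
  then show ?thesis by (simp add: balanced_iff_measure)
next
  case False
  then have pos: "0 < measure M UNIV" using measure_nonneg[of M UNIV] by linarith
  note sets = level_sets_measurable[OF Lip_measurable_M[OF assms]]
  define T where "T = {t. measure M {x. t < f x} \<le> measure M UNIV / 2}"
  have up: "t' \<in> T" if "t \<in> T" "t \<le> t'" for t t'
  proof -
    have "measure M {x. t' < f x} \<le> measure M {x. t < f x}"
      using that by (intro finite_measure_mono sets) auto
    then show ?thesis using that by (simp add: T_def)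
  qed
  have "(\<lambda>n. measure M {x. real n < f x}) \<longlonglongrightarrow> measure M (\<Inter>n. {x. real n < f x})"
    using sets by (intro finite_Lim_measure_decseq) (auto simp: decseq_def intro: le_less_trans)
  moreover have "(\<Inter>n. {x. real n < f x}) = {}"
  proof -
    have "x \<notin> (\<Inter>n. {x. real n < f x})" for x
    proof -
      obtain n where "f x \<le> real n" using real_arch_simple by blast
      then have "\<not> real n < f x" by simp
      then show ?thesis by blast
    qed
    then show ?thesis by blast
  qed
  ultimately have "(\<lambda>n. measure M {x. real n < f x}) \<longlonglongrightarrow> 0" by simp
  then have "eventually (\<lambda>n. measure M {x. real n < f x} < measure M UNIV / 2) sequentially"
    using pos by (intro order_tendstoD(2)) auto
  then obtain n where "real n \<in> T" by (auto simp: T_def eventually_sequentially intro: less_imp_le)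
  then have ne: "T \<noteq> {}" by auto
  have "(\<lambda>n. measure M {x. - real n < f x}) \<longlonglongrightarrow> measure M (\<Union>n. {x. - real n < f x})"
    using sets by (intro finite_Lim_measure_incseq) (auto simp: incseq_def intro: le_less_trans[rotated])
  moreover have "(\<Union>n. {x. - real n < f x}) = UNIV"
  proof -
    have "\<exists>n. - f x < real n" for x by (rule reals_Archimedean2)
    then show ?thesis by (auto simp: minus_less_iff)
  qed
  ultimately have "(\<lambda>n. measure M {x. - real n < f x}) \<longlonglongrightarrow> measure M UNIV" by simp
  then have "eventually (\<lambda>n. measure M UNIV / 2 < measure M {x. - real n < f x}) sequentially"
    using pos by (intro order_tendstoD(1)) auto
  then obtain n' where n': "- real n' \<notin> T" by (auto simp: T_def eventually_sequentially not_le)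
  have bdd: "bdd_below T"
    using up n' by (intro bdd_belowI[of _ "- real n'"]) (meson linear)
  define m where "m = Inf T"
  have less: "t \<notin> T" if "t < m" for t
    using that cInf_lower[OF _ bdd] unfolding m_def by (auto simp: not_le[symmetric])
  have greater: "t \<in> T" if "m < t" for t
    using that up cInf_lessD[OF ne, of t] unfolding m_def by (auto intro: less_imp_le)
  \<comment> \<open>Levels above \<open>m\<close> belong to \<open>T\<close>, and their superlevel
    sets increase to \<open>{f > m}\<close>.\<close>
  have "(\<lambda>n. measure M {x. m + inverse (real (Suc n)) < f x})
      \<longlonglongrightarrow> measure M (\<Union>n. {x. m + inverse (real (Suc n)) < f x})"
  proof (intro finite_Lim_measure_incseq)
    show "incseq (\<lambda>n. {x. m + inverse (real (Suc n)) < f x})"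
    proof (intro incseq_SucI subsetI CollectI)
      fix n x assume "x \<in> {x. m + inverse (real (Suc n)) < f x}"
      moreover have "inverse (real (Suc (Suc n))) \<le> inverse (real (Suc n))"
        by (intro le_imp_inverse_le) auto
      ultimately show "m + inverse (real (Suc (Suc n))) < f x" unfolding mem_Collect_eq by linarith
    qed
  qed (use sets in auto)
  moreover have "(\<Union>n. {x. m + inverse (real (Suc n)) < f x}) = {x. 0 < f x - m}"
  proof safe
    fix x n assume "m + inverse (real (Suc n)) < f x"
    moreover have "0 < inverse (real (Suc n))" by simp
    ultimately show "0 < f x - m" by linarith
  next
    fix x assume "0 < f x - m"
    then obtain n where "inverse (real (Suc n)) < f x - m" using reals_Archimedean by blast
    then show "x \<in> (\<Union>n. {x. m + inverse (real (Suc n)) < f x})" by (auto simp: less_diff_eq add.commute simp del: of_nat_Suc)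
  qed
  ultimately have "(\<lambda>n. measure M {x. m + inverse (real (Suc n)) < f x}) \<longlonglongrightarrow> measure M {x. 0 < f x - m}"
    by simp
  moreover have "measure M {x. m + inverse (real (Suc n)) < f x} \<le> measure M UNIV / 2" for n
    using greater[of "m + inverse (real (Suc n))"] by (simp add: T_def del: of_nat_Suc)
  ultimately have a: "measure M {x. 0 < f x - m} \<le> measure M UNIV / 2"
    by (intro LIMSEQ_le_const2) auto
  \<comment> \<open>Levels below \<open>m\<close> are not in \<open>T\<close>, so the complements of
    their superlevel sets have less than half the mass; these complements increase to
    \<open>{f < m}\<close>.\<close>
  have "(\<lambda>n. measure M {x. f x \<le> m - inverse (real (Suc n))})
      \<longlonglongrightarrow> measure M (\<Union>n. {x. f x \<le> m - inverse (real (Suc n))})"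
  proof (intro finite_Lim_measure_incseq)
    show "incseq (\<lambda>n. {x. f x \<le> m - inverse (real (Suc n))})"
    proof (intro incseq_SucI subsetI CollectI)
      fix n x assume "x \<in> {x. f x \<le> m - inverse (real (Suc n))}"
      moreover have "inverse (real (Suc (Suc n))) \<le> inverse (real (Suc n))"
        by (intro le_imp_inverse_le) auto
      ultimately show "f x \<le> m - inverse (real (Suc (Suc n)))" unfolding mem_Collect_eq by linarith
    qed
  qed (use sets in auto)
  moreover have "(\<Union>n. {x. f x \<le> m - inverse (real (Suc n))}) = {x. f x - m < 0}"
  proof safe
    fix x n assume "f x \<le> m - inverse (real (Suc n))"
    moreover have "0 < inverse (real (Suc n))" by simp
    ultimately show "f x - m < 0" by linarith
  next
    fix x assume "f x - m < 0"
    then obtain n where "inverse (real (Suc n)) < m - f x" using reals_Archimedean[of "m - f x"] by auto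
    then have "f x \<le> m - inverse (real (Suc n))" by linarith
    then show "x \<in> (\<Union>n. {x. f x \<le> m - inverse (real (Suc n))})" by blast
  qed
  ultimately have "(\<lambda>n. measure M {x. f x \<le> m - inverse (real (Suc n))}) \<longlonglongrightarrow> measure M {x. f x - m < 0}"
    by simp
  moreover have "measure M {x. f x \<le> m - inverse (real (Suc n))} \<le> measure M UNIV / 2" for n
  proof -
    let ?t = "m - inverse (real (Suc n))"
    have "?t \<notin> T" by (intro less) simp
    moreover have "measure M {x. f x \<le> ?t} = measure M UNIV - measure M {x. ?t < f x}"
      using finite_measure_compl[OF sets(2)[of ?t]]
      by (simp add: space_eq_UNIV Collect_neg_eq[symmetric] Compl_eq_Diff_UNIV[symmetric] not_less del: of_nat_Suc)
    ultimately show ?thesis by (simp add: T_def del: of_nat_Suc)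
  qed
  ultimately have b: "measure M {x. f x - m < 0} \<le> measure M UNIV / 2"
    by (intro LIMSEQ_le_const2) auto
  show ?thesis using a b by (auto simp: balanced_iff_measure)
qed

text \<open>The integral of \<open>|f - m|\<close> is at least \<open>|m| \<mu>(\<Omega>)\<close>; Young's inequality converts this into a bound on
  the \<open>p\<close>-th moment without appealing to Jensen or Hoelder.\<close>

lemma mean_zero_const_moment:
  assumes f: "f \<in> Lip" "integrable M f" "(\<integral>x. f x \<partial>M) = 0" and p: "1 < p"
  shows "ennreal (\<bar>m\<bar> powr p) * emeasure M UNIV
    \<le> ennreal (2 powr p) * (\<integral>\<^sup>+x. ennreal (\<bar>f x - m\<bar> powr p) \<partial>M)"
proof (cases "m = 0")
  case False
  have [measurable]: "f \<in> borel_measurable M" using f(1) by (rule Lip_measurable_M)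
  define X where "X = (\<integral>\<^sup>+x. ennreal (\<bar>f x - m\<bar> powr p) \<partial>M)"
  \<comment> \<open>To be applied with \<open>s = |f x - m|\<close>. The first summand integrates to
    half of \<open>|m| powr p\<close> times the total mass, which is finite and can be
    absorbed.\<close>
  have pointwise: "\<bar>m\<bar> powr (p - 1) * s \<le> \<bar>m\<bar> powr p / 2 + 2 powr (p - 1) * s powr p" if "0 \<le> s" for s :: real
  proof (cases "s \<le> \<bar>m\<bar> / 2")
    case True
    have "\<bar>m\<bar> powr (p - 1) * s \<le> \<bar>m\<bar> powr (p - 1) * (\<bar>m\<bar> / 2)"
      using True by (intro mult_left_mono) auto
    also have "\<dots> = \<bar>m\<bar> powr p / 2" using powr_mult_base[of "\<bar>m\<bar>" "p - 1"] by (simp add: mult.commute)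
    finally show ?thesis by (simp add: add_increasing2)
  next
    case False
    have "\<bar>m\<bar> powr (p - 1) * s \<le> (2 * s) powr (p - 1) * s"
      using False p that by (intro mult_right_mono powr_mono2) auto
    also have "\<dots> = 2 powr (p - 1) * s powr p"
      using that powr_mult_base[of s "p - 1"] by (simp add: powr_mult mult_ac)
    finally show ?thesis by (simp add: add_increasing)
  qed
  have int: "integrable M (\<lambda>x. f x - m)" using f(2) by simp
  have "(\<integral>x. f x - m \<partial>M) = - (m * measure M UNIV)"
    using f by (simp add: space_eq_UNIV)
  then have "ennreal (\<bar>m\<bar> * measure M UNIV) \<le> (\<integral>\<^sup>+x. ennreal \<bar>f x - m\<bar> \<partial>M)"
    using integral_norm_bound_ennreal[OF int] by (simp add: abs_mult)
  then have "ennreal (\<bar>m\<bar> powr (p - 1)) * ennreal (\<bar>m\<bar> * measure M UNIV)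
      \<le> ennreal (\<bar>m\<bar> powr (p - 1)) * (\<integral>\<^sup>+x. ennreal \<bar>f x - m\<bar> \<partial>M)"
    by (intro mult_left_mono) auto
  also have "\<dots> = (\<integral>\<^sup>+x. ennreal (\<bar>m\<bar> powr (p - 1) * \<bar>f x - m\<bar>) \<partial>M)"
    by (subst nn_integral_cmult[symmetric]) (auto simp: ennreal_mult)
  also have "\<dots> \<le> (\<integral>\<^sup>+x. ennreal (\<bar>m\<bar> powr p / 2 + 2 powr (p - 1) * \<bar>f x - m\<bar> powr p) \<partial>M)"
    by (intro nn_integral_mono ennreal_leI pointwise) auto
  also have "\<dots> = (\<integral>\<^sup>+x. ennreal (\<bar>m\<bar> powr p / 2) + ennreal (2 powr (p - 1)) * ennreal (\<bar>f x - m\<bar> powr p) \<partial>M)"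
    by (simp add: ennreal_mult ennreal_plus)
  also have "\<dots> = ennreal (\<bar>m\<bar> powr p / 2) * emeasure M UNIV + ennreal (2 powr (p - 1)) * X"
    unfolding X_def by (subst nn_integral_add) (auto simp: nn_integral_cmult space_eq_UNIV)
  also have "ennreal (\<bar>m\<bar> powr p / 2) * emeasure M UNIV = ennreal (1 / 2) * ennreal (\<bar>m\<bar> powr p * measure M UNIV)"
    by (subst ennreal_mult[symmetric]) (auto simp: emeasure_eq_measure simp flip: ennreal_mult)
  also have "ennreal (\<bar>m\<bar> powr (p - 1)) * ennreal (\<bar>m\<bar> * measure M UNIV) = ennreal (\<bar>m\<bar> powr p * measure M UNIV)"
    using powr_mult_base[of "\<bar>m\<bar>" "p - 1"] by (simp add: mult_ac flip: ennreal_mult)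
  finally have "ennreal (\<bar>m\<bar> powr p * measure M UNIV) \<le> ennreal 2 * (ennreal (2 powr (p - 1)) * X)"
    by (intro ennreal_absorb_half) auto
  also have "\<dots> = ennreal (2 * 2 powr (p - 1)) * X"
    by (subst ennreal_mult) (auto simp: mult.assoc)
  also have "2 * 2 powr (p - 1) = 2 powr p" using powr_mult_base[of 2 "p - 1"] by simp
  finally show ?thesis by (simp add: X_def ennreal_mult emeasure_eq_measure)
qed simp

text \<open>On the side of the level \<open>m\<close> facing away from 0 one has
  \<open>|f| \<ge> |m|\<close>, and by balance this side carries at least half the mass.\<close>

lemma balanced_const_moment:
  assumes f: "f \<in> Lip" and bal: "balanced M (\<lambda>x. f x - m)" and p: "0 < p"
  shows "ennreal (\<bar>m\<bar> powr p) * emeasure M UNIV \<le> ennreal 2 * (\<integral>\<^sup>+x. ennreal (\<bar>f x\<bar> powr p) \<partial>M)"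
proof -
  note sets = level_sets_measurable[OF Lip_measurable_M[OF f]]
  define S where "S = (if 0 < m then {x. m \<le> f x} else {x. f x \<le> m})"
  have S: "S \<in> sets M" using sets by (simp add: S_def)
  have "measure M {x. f x < m} \<le> measure M UNIV / 2" "measure M {x. m < f x} \<le> measure M UNIV / 2"
    using bal by (auto simp: balanced_iff_measure)
  moreover have "UNIV - S = (if 0 < m then {x. f x < m} else {x. m < f x})" by (auto simp: S_def)
  moreover have "measure M (UNIV - S) = measure M UNIV - measure M S"
    using finite_measure_compl[OF S] by (simp add: space_eq_UNIV)
  ultimately have "measure M UNIV \<le> 2 * measure M S" by (auto split: if_splits)
  then have "ennreal (\<bar>m\<bar> powr p) * emeasure M UNIV \<le> ennreal (\<bar>m\<bar> powr p) * ennreal (2 * measure M S)"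
    by (intro mult_left_mono) (auto simp: emeasure_eq_measure intro: ennreal_leI)
  also have "ennreal (2 * measure M S) = ennreal 2 * emeasure M S"
    unfolding emeasure_eq_measure by (intro ennreal_mult) auto
  also have "ennreal (\<bar>m\<bar> powr p) * (ennreal 2 * emeasure M S) = ennreal 2 * (ennreal (\<bar>m\<bar> powr p) * emeasure M S)"
    by (rule mult.left_commute)
  also have "ennreal (\<bar>m\<bar> powr p) * emeasure M S = (\<integral>\<^sup>+x. ennreal (\<bar>m\<bar> powr p) * indicator S x \<partial>M)"
    using S by (simp add: nn_integral_cmult_indicator)
  also have "\<dots> \<le> (\<integral>\<^sup>+x. ennreal (\<bar>f x\<bar> powr p) \<partial>M)"
  proof (intro nn_integral_mono)
    fix x
    have "\<bar>m\<bar> \<le> \<bar>f x\<bar>" if "x \<in> S" using that by (auto simp: S_def split: if_splits)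
    then show "ennreal (\<bar>m\<bar> powr p) * indicator S x \<le> ennreal (\<bar>f x\<bar> powr p)"
      using p by (auto simp: indicator_def intro!: ennreal_leI powr_mono2)
  qed
  finally show ?thesis by (simp add: mult_left_mono)
qed

lemma half_total_quotient_finite: "\<exists>K\<ge>0. iso_quotient M (emeasure M UNIV / 2) \<le> ennreal K"
proof (cases "emeasure M UNIV = 0")
  case False
  let ?t = "emeasure M UNIV / 2"
  have t: "0 < ?t" "?t < \<infinity>" "?t < emeasure M (space M)"
    using False finite_total less_total_if_le_half[of ?t]
    by (auto simp: space_eq_UNIV zero_less_iff_neq_zero ennreal_divide_eq_top_iff less_top[symmetric])
  have "?t / iso_profile M ?t \<noteq> \<infinity>"
    using t profile_pos[OF t(1,3)] by (auto simp: ennreal_divide_eq_top_iff)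
  then have "iso_quotient M ?t \<noteq> \<infinity>"
    using t by (auto simp: iso_quotient_def)
  then show ?thesis by (cases "iso_quotient M ?t") auto
qed (auto simp: iso_quotient_def)

text \<open>\<open>balanced_moment\<close> with \<open>A\<close> the whole space: the complement is
  empty, and the quotient at half the total measure is finite because the profile is positive
  there.\<close>

lemma Poincare_moment:
  assumes p: "1 < p"
  obtains K where "0 \<le> K" "\<And>g. g \<in> Lip \<Longrightarrow> balanced M g \<Longrightarrow>
    (\<integral>\<^sup>+x. ennreal (\<bar>g x\<bar> powr p) \<partial>M) \<le> ennreal K * (\<integral>\<^sup>+x. ennreal (\<bar>grad_norm g x\<bar> powr p) \<partial>M)"
proof -
  obtain k where k: "0 \<le> k" "iso_quotient M (emeasure M UNIV / 2) \<le> ennreal k"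
    using half_total_quotient_finite by blast
  have min: "min (emeasure M UNIV) (emeasure M UNIV / 2) = emeasure M UNIV / 2"
    by (rule min_absorb2) (simp add: emeasure_eq_measure ennreal_divide_numeral ennreal_leI)
  show thesis
  proof (rule that)
    let ?K = "2 * (young_const p (1 / 2) * k powr p)"
    show "0 \<le> ?K" using young_const_pos[of p "1 / 2"] p by simp
    fix g assume g: "g \<in> Lip" "balanced M g"
    have "(\<integral>\<^sup>+x. ennreal (\<bar>g x\<bar> powr p) \<partial>M)
      \<le> ennreal 2 * (ennreal (young_const p (1 / 2) * k powr p) * (\<integral>\<^sup>+x. ennreal (\<bar>grad_norm g x\<bar> powr p) \<partial>M)
        + (\<integral>\<^sup>+x. indicator (- UNIV) x * ennreal (\<bar>g x\<bar> powr p) \<partial>M))"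
      by (rule balanced_moment[OF g _ p k(1)]) (simp_all add: space_eq_UNIV min k sets_borel)
    also have "\<dots> = ennreal 2 * ennreal (young_const p (1 / 2) * k powr p) * (\<integral>\<^sup>+x. ennreal (\<bar>grad_norm g x\<bar> powr p) \<partial>M)"
      by (simp add: mult.assoc)
    also have "ennreal 2 * ennreal (young_const p (1 / 2) * k powr p) = ennreal ?K"
      using young_const_pos[of p "1 / 2"] p by (intro ennreal_mult[symmetric]) auto
    finally show "(\<integral>\<^sup>+x. ennreal (\<bar>g x\<bar> powr p) \<partial>M) \<le> ennreal ?K * (\<integral>\<^sup>+x. ennreal (\<bar>grad_norm g x\<bar> powr p) \<partial>M)" .
  qed
qed

text \<open>The constants are chosen so that the \<open>\<delta>\<close>-term and the term \<open>|m|\<^sup>p \<mu>(A)\<close> each contribute one quarter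
  of \<open>\<integral> |f|\<^sup>p\<close>.\<close>

lemma centered_small_set_moment:
  assumes f: "f \<in> Lip" "balanced M (\<lambda>x. f x - m)"
    and X: "(\<integral>\<^sup>+x. ennreal (\<bar>f x - m\<bar> powr p) \<partial>M) < \<infinity>"
    and A: "A \<in> sets M" "emeasure M A \<le> ennreal (1 / (8 * 2 powr p)) * emeasure M UNIV"
    and p: "1 < p" and K: "0 \<le> K" "iso_quotient M (min (emeasure M A) (emeasure M (space M) / 2)) \<le> ennreal K"
  shows "(\<integral>\<^sup>+x. ennreal (\<bar>f x\<bar> powr p) \<partial>M)
    \<le> ennreal 2 * (ennreal (2 powr p * (young_const p (1 / (12 * (2 powr p * 2 powr p))) * K powr p))
          * (\<integral>\<^sup>+x. ennreal (\<bar>grad_norm f x\<bar> powr p) \<partial>M)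
        + (\<integral>\<^sup>+x. indicator (- A) x * ennreal (\<bar>f x\<bar> powr p) \<partial>M))"
proof -
  have [measurable]: "f \<in> borel_measurable M" using f(1) by (rule Lip_measurable_M)
  have UNIV: "UNIV \<in> sets M" by (simp add: sets_borel)
  have nA[measurable]: "- A \<in> sets M" "A \<in> sets M"
    using sets.compl_sets[OF A(1)] A(1) by (simp_all add: space_eq_UNIV Compl_eq_Diff_UNIV)
  \<comment> \<open>The moment of \<open>f - m\<close> is at most \<open>3 * 2 powr p\<close> times
    that of \<open>f\<close>, and returning from \<open>f - m\<close> to \<open>f\<close> costs
    another \<open>2 powr p\<close>; dividing by 12 instead of 3 leaves one quarter.\<close>
  define \<delta> where "\<delta> = 1 / (12 * (2 powr p * 2 powr p))"
  have "0 < \<delta>" by (simp add: \<delta>_def)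
  define F where "F = (\<integral>\<^sup>+x. ennreal (\<bar>f x\<bar> powr p) \<partial>M)"
  define X where "X = (\<integral>\<^sup>+x. ennreal (\<bar>f x - m\<bar> powr p) \<partial>M)"
  define Y where "Y = (\<integral>\<^sup>+x. indicator (- A) x * ennreal (\<bar>f x\<bar> powr p) \<partial>M)"
  define Z where "Z = ennreal (young_const p \<delta> * K powr p) * (\<integral>\<^sup>+x. ennreal (\<bar>grad_norm f x\<bar> powr p) \<partial>M)"
  define T where "T = ennreal (\<bar>m\<bar> powr p) * emeasure M UNIV"
  have T_fin: "T < \<infinity>" by (simp add: T_def ennreal_mult_less_top emeasure_eq_measure)
  \<comment> \<open>Only the moment of \<open>f - m\<close> is assumed finite; finiteness of
    \<open>F\<close>, required for the absorption, follows since constants have finite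
    moment.\<close>
  have "F \<le> ennreal (2 powr p) * (X + T)"
    using moment_add_const_le[OF _ UNIV, of "\<lambda>x. f x - m" p m] p by (simp add: F_def X_def T_def)
  also have "\<dots> < \<infinity>"
    using T_fin assms(3) by (simp add: X_def ennreal_mult_less_top)
  finally have F_fin: "F < \<infinity>" .
  then obtain \<phi> where \<phi>: "F = ennreal \<phi>" "0 \<le> \<phi>" by (cases F) auto
  have T_le: "T \<le> ennreal (2 * \<phi>)"
    using balanced_const_moment[OF f, of p] p \<phi> by (simp add: T_def F_def ennreal_mult)
  have "X \<le> ennreal (2 powr p) * (F + T)"
    using moment_add_const_le[OF _ UNIV, of f p "- m"] p by (simp add: F_def X_def T_def)
  also have "\<dots> \<le> ennreal (2 powr p) * (ennreal \<phi> + ennreal (2 * \<phi>))"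
    using T_le \<phi> by (intro mult_left_mono add_mono) auto
  also have "\<dots> = ennreal (2 powr p * (3 * \<phi>))"
    using \<phi> by (simp flip: ennreal_mult ennreal_plus)
  finally have X_le: "X \<le> ennreal (2 powr p * (3 * \<phi>))" .
  have TA: "ennreal (\<bar>m\<bar> powr p) * emeasure M A \<le> ennreal (1 / (8 * 2 powr p) * (2 * \<phi>))"
  proof -
    have "ennreal (\<bar>m\<bar> powr p) * emeasure M A \<le> ennreal (\<bar>m\<bar> powr p) * (ennreal (1 / (8 * 2 powr p)) * emeasure M UNIV)"
      by (intro mult_left_mono A) auto
    also have "\<dots> = ennreal (1 / (8 * 2 powr p)) * T" by (simp add: T_def mult_ac)
    also have "\<dots> \<le> ennreal (1 / (8 * 2 powr p)) * ennreal (2 * \<phi>)" by (intro mult_left_mono T_le) auto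
    also have "\<dots> = ennreal (1 / (8 * 2 powr p) * (2 * \<phi>))" using \<phi> by (intro ennreal_mult[symmetric]) auto
    finally show ?thesis .
  qed
  have lip: "(\<lambda>x. f x - m) \<in> Lip"
    by (rule Lip_compose_contraction[OF f(1)]) auto
  have "(\<integral>\<^sup>+x. indicator A x * ennreal (\<bar>f x - m\<bar> powr p) \<partial>M) \<le> ennreal \<delta> * X + Z"
    using balanced_local_moment[OF lip f(2) A(1) p \<open>0 < \<delta>\<close> K] by (simp add: X_def Z_def grad_norm_diff_const)
  also have "\<dots> \<le> ennreal \<delta> * ennreal (2 powr p * (3 * \<phi>)) + Z"
    by (intro add_right_mono mult_left_mono X_le) auto
  also have "\<dots> = ennreal (\<delta> * (2 powr p * (3 * \<phi>))) + Z"
    using \<open>0 < \<delta>\<close> \<phi> by (simp add: ennreal_mult)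
  finally have XA: "(\<integral>\<^sup>+x. indicator A x * ennreal (\<bar>f x - m\<bar> powr p) \<partial>M) \<le> ennreal (\<delta> * (2 powr p * (3 * \<phi>))) + Z" .
  have "F = (\<integral>\<^sup>+x. indicator A x * ennreal (\<bar>f x\<bar> powr p) \<partial>M) + Y"
    unfolding F_def Y_def by (subst nn_integral_add[symmetric]) (auto intro!: nn_integral_cong simp: indicator_def)
  also have "(\<integral>\<^sup>+x. indicator A x * ennreal (\<bar>f x\<bar> powr p) \<partial>M)
      \<le> ennreal (2 powr p) * ((\<integral>\<^sup>+x. indicator A x * ennreal (\<bar>f x - m\<bar> powr p) \<partial>M) + ennreal (\<bar>m\<bar> powr p) * emeasure M A)"
    using moment_add_const_le[OF _ A(1), of "\<lambda>x. f x - m" p m] p by simp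
  also have "\<dots> \<le> ennreal (2 powr p) * ((ennreal (\<delta> * (2 powr p * (3 * \<phi>))) + Z) + ennreal (1 / (8 * 2 powr p) * (2 * \<phi>)))"
    by (intro mult_left_mono add_mono XA TA) auto
  also have "\<dots> = ennreal (2 powr p) * (ennreal (\<delta> * (2 powr p * (3 * \<phi>))) + ennreal (1 / (8 * 2 powr p) * (2 * \<phi>))) + ennreal (2 powr p) * Z"
    by (simp add: distrib_left add_ac)
  also have "ennreal (\<delta> * (2 powr p * (3 * \<phi>))) + ennreal (1 / (8 * 2 powr p) * (2 * \<phi>))
      = ennreal (\<delta> * (2 powr p * (3 * \<phi>)) + 1 / (8 * 2 powr p) * (2 * \<phi>))"
    using \<open>0 < \<delta>\<close> \<phi> by (intro ennreal_plus[symmetric]) auto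
  also have "ennreal (2 powr p) * \<dots> = ennreal (1 / 2 * \<phi>)"
  proof -
    have "2 powr p * (\<delta> * (2 powr p * (3 * \<phi>)) + 1 / (8 * 2 powr p) * (2 * \<phi>)) = 1 / 2 * \<phi>"
      by (simp add: \<delta>_def field_simps)
    then show ?thesis using \<open>0 < \<delta>\<close> \<phi> by (subst ennreal_mult[symmetric]) auto
  qed
  also have "ennreal (1 / 2 * \<phi>) = ennreal (1 / 2) * F"
    unfolding \<phi>(1) using \<phi> by (intro ennreal_mult) auto
  finally have "F \<le> ennreal (1 / 2) * F + (ennreal (2 powr p) * Z + Y)"
    by (simp add: add_right_mono add.assoc)
  from ennreal_absorb_half[OF F_fin this]
  have "F \<le> ennreal 2 * (ennreal (2 powr p) * Z + Y)" .
  also have "ennreal (2 powr p) * Z = ennreal (2 powr p * (young_const p \<delta> * K powr p))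
      * (\<integral>\<^sup>+x. ennreal (\<bar>grad_norm f x\<bar> powr p) \<partial>M)"
    using young_const_pos[OF p \<open>0 < \<delta>\<close>] by (subst ennreal_mult) (auto simp: Z_def mult.assoc)
  finally show ?thesis by (simp only: F_def Y_def \<delta>_def)
qed

text \<open>Continuity from above: the sets \<open>{w \<le> 1 / (n + 1)}\<close> decrease to a
  subset of \<open>{w \<le> 0}\<close>, which is null because \<open>w\<close> is positive almost
  everywhere.\<close>

lemma small_sublevel:
  assumes w: "isoperimetric_weight M w" and "0 < \<epsilon>"
  shows "\<exists>r0>0. \<forall>r. r < r0 \<longrightarrow> emeasure M {x. w x \<le> r} \<le> ennreal \<epsilon> * emeasure M UNIV"
proof (cases "measure M UNIV = 0")
  case True
  then have "measure M A = 0" for A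
    using bounded_measure[of A] measure_nonneg[of M A] by (simp add: space_eq_UNIV)
  then show ?thesis by (auto simp: emeasure_eq_measure intro: exI[of _ 1])
next
  case False
  then have pos: "0 < measure M UNIV" using measure_nonneg[of M UNIV] by linarith
  note sets = weight_sublevel_sets[OF w]
  have "(\<lambda>n. measure M {x. w x \<le> inverse (real (Suc n))}) \<longlonglongrightarrow> measure M (\<Inter>n. {x. w x \<le> inverse (real (Suc n))})"
  proof (intro finite_Lim_measure_decseq)
    show "decseq (\<lambda>n. {x. w x \<le> inverse (real (Suc n))})"
    proof (intro decseq_SucI subsetI CollectI)
      fix n x assume "x \<in> {x. w x \<le> inverse (real (Suc (Suc n)))}"
      moreover have "inverse (real (Suc (Suc n))) \<le> inverse (real (Suc n))"
        by (intro le_imp_inverse_le) auto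
      ultimately show "w x \<le> inverse (real (Suc n))" unfolding mem_Collect_eq by linarith
    qed
  qed (use sets in auto)
  moreover have "measure M (\<Inter>n. {x. w x \<le> inverse (real (Suc n))}) = 0"
  proof -
    have "AE x in M. 0 < w x" using w by (simp add: isoperimetric_weight_def)
    then have "AE x in M. x \<notin> {x. w x \<le> 0}" by eventually_elim auto
    then have "measure M {x. w x \<le> 0} = 0"
      using sets by (subst (asm) AE_iff_measurable[OF _ refl]) (auto simp: space_eq_UNIV emeasure_eq_measure)
    moreover have "(\<Inter>n. {x. w x \<le> inverse (real (Suc n))}) \<subseteq> {x. w x \<le> 0}"
    proof (rule subsetI, rule ccontr)
      fix x assume x: "x \<in> (\<Inter>n. {x. w x \<le> inverse (real (Suc n))})" "x \<notin> {x. w x \<le> 0}"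
      then have "0 < w x" by simp
      then obtain n where "inverse (real (Suc n)) < w x" using reals_Archimedean by blast
      moreover have "w x \<le> inverse (real (Suc n))" using x(1) by blast
      ultimately show False by linarith
    qed
    ultimately show ?thesis
      using finite_measure_mono[OF _ sets, of "\<Inter>n. {x. w x \<le> inverse (real (Suc n))}" 0]
        measure_nonneg[of M "\<Inter>n. {x. w x \<le> inverse (real (Suc n))}"] by linarith
  qed
  ultimately have "(\<lambda>n. measure M {x. w x \<le> inverse (real (Suc n))}) \<longlonglongrightarrow> 0" by simp
  then have "eventually (\<lambda>n. measure M {x. w x \<le> inverse (real (Suc n))} < \<epsilon> * measure M UNIV) sequentially"
    using pos \<open>0 < \<epsilon>\<close> by (intro order_tendstoD(2)) auto
  then obtain n where n: "measure M {x. w x \<le> inverse (real (Suc n))} < \<epsilon> * measure M UNIV"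
    by (auto simp: eventually_sequentially)
  show ?thesis
  proof (intro exI[of _ "inverse (real (Suc n))"] conjI allI impI)
    fix r :: real assume r: "r < inverse (real (Suc n))"
    have "measure M {x. w x \<le> r} \<le> measure M {x. w x \<le> inverse (real (Suc n))}"
      using r by (intro finite_measure_mono sets) auto
    with n have "measure M {x. w x \<le> r} \<le> \<epsilon> * measure M UNIV" by linarith
    then show "emeasure M {x. w x \<le> r} \<le> ennreal \<epsilon> * emeasure M UNIV"
      using \<open>0 < \<epsilon>\<close> by (simp add: emeasure_eq_measure ennreal_leI flip: ennreal_mult)
  qed simp
qed

lemma mean_zero_weighted_moment:
  assumes w: "isoperimetric_weight M w" and p: "1 < p"
  obtains c where "0 \<le> c" "\<And>f r \<alpha>. f \<in> Lip \<Longrightarrow> integrable M f \<Longrightarrow> (\<integral>x. f x \<partial>M) = 0 \<Longrightarrow> 0 < (r::real) \<Longrightarrow> 0 < (\<alpha>::real) \<Longrightarrow>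
    (\<integral>\<^sup>+x. ennreal (\<bar>f x\<bar> powr p) \<partial>M)
    \<le> ennreal 2 * (ennreal (c * r powr p) * (\<integral>\<^sup>+x. ennreal (\<bar>grad_norm f x\<bar> powr p) \<partial>M)
      + ennreal ((r powr (- \<alpha>)) powr p) * (\<integral>\<^sup>+x. ennreal (\<bar>w x powr \<alpha> * \<bar>f x\<bar>\<bar> powr p) \<partial>M))"
proof -
  obtain C where C: "0 < C" "\<And>r. 0 < r \<Longrightarrow>
      iso_quotient M (min (emeasure M {x. w x \<le> r}) (emeasure M (space M) / 2)) \<le> ennreal (C * r)"
    using weight_sublevel_bound[OF w] by blast
  obtain K where K: "0 \<le> K" "\<And>g. g \<in> Lip \<Longrightarrow> balanced M g \<Longrightarrow>
      (\<integral>\<^sup>+x. ennreal (\<bar>g x\<bar> powr p) \<partial>M) \<le> ennreal K * (\<integral>\<^sup>+x. ennreal (\<bar>grad_norm g x\<bar> powr p) \<partial>M)"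
    using Poincare_moment[OF p] by blast
  obtain r0 where r0: "0 < r0" "\<And>r. r < r0 \<Longrightarrow> emeasure M {x. w x \<le> r} \<le> ennreal (1 / (8 * 2 powr p)) * emeasure M UNIV"
    using small_sublevel[OF w, of "1 / (8 * 2 powr p)"] by auto
  \<comment> \<open>\<open>c1\<close> serves the radii below \<open>r0\<close>, with
    \<open>K = C * r\<close> in \<open>centered_small_set_moment\<close>. \<open>c2\<close> serves
    the others: dividing by \<open>r0 powr p\<close> turns the constant from the Poincare inequality
    into one at most \<open>c2 * r powr p\<close> once \<open>r \<ge> r0\<close>. Neither involves
    \<open>f\<close>, \<open>r\<close> or \<open>\<alpha>\<close>.\<close>
  define c1 where "c1 = 2 powr p * (young_const p (1 / (12 * (2 powr p * 2 powr p))) * C powr p)"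
  define c2 where "c2 = 2 powr p * ((1 + 2 powr p) * K) / r0 powr p"
  have c: "0 < c1" "0 \<le> c2"
    using C(1) K(1) young_const_pos[OF p, of "1 / (12 * (2 powr p * 2 powr p))"] by (auto simp: c1_def c2_def)
  have w_meas: "w \<in> borel_measurable M" using w by (simp add: isoperimetric_weight_def)
  have UNIV: "UNIV \<in> sets M" by (simp add: sets_borel)
  show thesis
  proof (rule that)
    show "0 \<le> c1 + c2" using c by simp
    fix f :: "'a \<Rightarrow> real" and r \<alpha> :: real
    assume f: "f \<in> Lip" "integrable M f" "(\<integral>x. f x \<partial>M) = 0" and r: "0 < r" and \<alpha>: "0 < \<alpha>"
    have fm[measurable]: "f \<in> borel_measurable M" using f(1) by (rule Lip_measurable_M)
    define F where "F = (\<integral>\<^sup>+x. ennreal (\<bar>f x\<bar> powr p) \<partial>M)"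
    define G where "G = (\<integral>\<^sup>+x. ennreal (\<bar>grad_norm f x\<bar> powr p) \<partial>M)"
    define Y where "Y = ennreal ((r powr (- \<alpha>)) powr p) * (\<integral>\<^sup>+x. ennreal (\<bar>w x powr \<alpha> * \<bar>f x\<bar>\<bar> powr p) \<partial>M)"
    obtain m where m: "balanced M (\<lambda>x. f x - m)" using exists_balancing_constant[OF f(1)] by blast
    define X where "X = (\<integral>\<^sup>+x. ennreal (\<bar>f x - m\<bar> powr p) \<partial>M)"
    have lip: "(\<lambda>x. f x - m) \<in> Lip"
      by (rule Lip_compose_contraction[OF f(1)]) auto
    have XG: "X \<le> ennreal K * G"
      using K(2)[OF lip m] by (simp add: X_def G_def grad_norm_diff_const)
    have "F \<le> ennreal 2 * (ennreal ((c1 + c2) * r powr p) * G + Y)"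
    \<comment> \<open>If \<open>G\<close> is infinite, so is the right-hand side, as its coefficient
      is positive. If it is finite, the Poincare inequality makes \<open>X\<close> finite, which the
      small-radius case needs.\<close>
    proof (cases "G = \<infinity>")
      case True
      have "ennreal ((c1 + c2) * r powr p) \<noteq> 0" using c r by simp
      then have "ennreal ((c1 + c2) * r powr p) * G = \<infinity>"
        using True by (simp only: infinity_ennreal_def ennreal_mult_top if_False)
      then show ?thesis by (simp add: ennreal_mult_top)
    next
      case G_fin: False
      show ?thesis
      proof (cases "r < r0")
        case True
        have "X < \<infinity>"
          using G_fin by (intro le_less_trans[OF XG]) (auto simp: ennreal_mult_eq_top_iff less_top[symmetric])
        then have "F \<le> ennreal 2 * (ennreal (2 powr p * (young_const p (1 / (12 * (2 powr p * 2 powr p))) * (C * r) powr p)) * G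
            + (\<integral>\<^sup>+x. indicator (- {x. w x \<le> r}) x * ennreal (\<bar>f x\<bar> powr p) \<partial>M))"
          unfolding F_def G_def X_def using C r
          by (intro centered_small_set_moment[OF f(1) m _ weight_sublevel_sets[OF w] r0(2)[OF True] p]) auto
        also have "2 powr p * (young_const p (1 / (12 * (2 powr p * 2 powr p))) * (C * r) powr p) = c1 * r powr p"
          using C(1) r by (simp add: c1_def powr_mult)
        also have "ennreal 2 * (ennreal (c1 * r powr p) * G + (\<integral>\<^sup>+x. indicator (- {x. w x \<le> r}) x * ennreal (\<bar>f x\<bar> powr p) \<partial>M))
          \<le> ennreal 2 * (ennreal ((c1 + c2) * r powr p) * G + Y)"
          unfolding Y_def using c p
          by (intro mult_left_mono add_mono mult_right_mono ennreal_leI weight_tail_moment_le w_meas fm r \<alpha>) auto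
        finally show ?thesis .
      next
        case False
        have "F \<le> ennreal (2 powr p) * (X + ennreal (\<bar>m\<bar> powr p) * emeasure M UNIV)"
          using moment_add_const_le[OF _ UNIV, of "\<lambda>x. f x - m" p m] p by (simp add: F_def X_def)
        also have "\<dots> \<le> ennreal (2 powr p) * (X + ennreal (2 powr p) * X)"
          using mean_zero_const_moment[OF f p, of m] by (intro mult_left_mono add_left_mono) (auto simp: X_def)
        also have "\<dots> \<le> ennreal (2 powr p) * (ennreal K * G + ennreal (2 powr p) * (ennreal K * G))"
          by (intro mult_left_mono add_mono XG) auto
        also have "\<dots> = ennreal (2 powr p * ((1 + 2 powr p) * K)) * G"
        proof -
          obtain g where "G = ennreal g" "0 \<le> g" using G_fin by (cases G) auto
          then show ?thesis using K(1) by (simp add: algebra_simps flip: ennreal_mult ennreal_plus)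
        qed
        also have "2 powr p * ((1 + 2 powr p) * K) = c2 * r0 powr p"
          using r0(1) by (simp add: c2_def)
        also have "ennreal (c2 * r0 powr p) * G \<le> ennreal ((c1 + c2) * r powr p) * G"
          using c False r0(1) p by (intro mult_right_mono ennreal_leI mult_mono powr_mono2) auto
        also have "\<dots> \<le> ennreal 2 * (ennreal ((c1 + c2) * r powr p) * G + Y)"
        proof -
          have "1 * (ennreal ((c1 + c2) * r powr p) * G) \<le> ennreal 2 * (ennreal ((c1 + c2) * r powr p) * G + Y)"
            by (intro mult_mono) auto
          then show ?thesis by simp
        qed
        finally show ?thesis .
      qed
    qed
    then show "(\<integral>\<^sup>+x. ennreal (\<bar>f x\<bar> powr p) \<partial>M)
      \<le> ennreal 2 * (ennreal ((c1 + c2) * r powr p) * (\<integral>\<^sup>+x. ennreal (\<bar>grad_norm f x\<bar> powr p) \<partial>M)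
        + ennreal ((r powr (- \<alpha>)) powr p) * (\<integral>\<^sup>+x. ennreal (\<bar>w x powr \<alpha> * \<bar>f x\<bar>\<bar> powr p) \<partial>M))"
      by (simp only: F_def G_def Y_def)
  qed
qed

end

end

theorem theorem4:
  fixes M :: "'a::metric_space measure" and w :: "'a \<Rightarrow> real" and p :: real
  assumes "isoperimetric_space M"
    and "isoperimetric_weight M w"
    and "p > 1"
  shows "\<exists>D::real. D > 0 \<and> (\<forall>\<alpha>::real. \<alpha> > 0 \<longrightarrow>
    (emeasure M (space M) < \<infinity> \<longrightarrow>
      (\<forall>f\<in>Lip. is_median M f 0 \<or> (integrable M f \<and> (\<integral>x. f x \<partial>M) = 0) \<longrightarrow>
        (\<forall>r::real. r > 0 \<longrightarrow>
          Lp_norm M p f \<le> ennreal (D * r) * Lp_norm M p (grad_norm f)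
            + ennreal (2 * r powr (- \<alpha>)) * Lp_norm M p (\<lambda>x. w x powr \<alpha> * \<bar>f x\<bar>)))) \<and>
    (emeasure M (space M) = \<infinity> \<longrightarrow>
      (\<forall>f\<in>Lip0. \<forall>r::real. r > 0 \<longrightarrow>
          Lp_norm M p f \<le> ennreal (D * r) * Lp_norm M p (grad_norm f)
            + ennreal (2 * r powr (- \<alpha>)) * Lp_norm M p (\<lambda>x. w x powr \<alpha> * \<bar>f x\<bar>))))"
proof -
  interpret isoperimetric_space M by fact
  note w = assms(2) and p = assms(3)
  obtain C where C: "0 < C" "\<And>r. 0 < r \<Longrightarrow>
      iso_quotient M (min (emeasure M {x. w x \<le> r}) (emeasure M (space M) / 2)) \<le> ennreal (C * r)"
    using weight_sublevel_bound[OF w] by blast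
  define c1 where "c1 = young_const p (1 / 2) * C powr p"
  have c1: "0 < c1" using young_const_pos[OF p, of "1 / 2"] C(1) by (simp add: c1_def)
  have balanced_bound: "Lp_norm M p f \<le> ennreal (D * r) * Lp_norm M p (grad_norm f)
      + ennreal (2 * r powr (- \<alpha>)) * Lp_norm M p (\<lambda>x. w x powr \<alpha> * \<bar>f x\<bar>)"
    if "f \<in> Lip" "balanced M f" "0 < r" "0 < \<alpha>" "0 < D" "2 * c1 \<le> D powr p" for f r \<alpha> D
    using that c1 balanced_weighted_moment[OF w that(1,2) C(1) C(2)[OF that(3)] p that(3,4)]
    by (intro Lp_norm_interpolation_if_moment_le[where c = c1] p) (auto simp: c1_def)
  show ?thesis
  proof (cases "emeasure M (space M) < \<infinity>")
    case True
    obtain c2 where c2: "0 \<le> c2" "\<And>f r \<alpha>. f \<in> Lip \<Longrightarrow> integrable M f \<Longrightarrow> (\<integral>x. f x \<partial>M) = 0 \<Longrightarrow> 0 < (r::real) \<Longrightarrow> 0 < (\<alpha>::real) \<Longrightarrow>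
        (\<integral>\<^sup>+x. ennreal (\<bar>f x\<bar> powr p) \<partial>M)
        \<le> ennreal 2 * (ennreal (c2 * r powr p) * (\<integral>\<^sup>+x. ennreal (\<bar>grad_norm f x\<bar> powr p) \<partial>M)
          + ennreal ((r powr (- \<alpha>)) powr p) * (\<integral>\<^sup>+x. ennreal (\<bar>w x powr \<alpha> * \<bar>f x\<bar>\<bar> powr p) \<partial>M))"
      using mean_zero_weighted_moment[OF True w p] by blast
    \<comment> \<open>\<open>D powr p = 2 * (c1 + c2)\<close>, so one constant covers both
      normalisations of \<open>f\<close>; it is fixed before \<open>\<alpha>\<close> is
      chosen.\<close>
    define D where "D = (2 * (c1 + c2)) powr (1 / p)"
    have D: "0 < D" "2 * c1 \<le> D powr p" "2 * c2 \<le> D powr p"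
      using c1 c2(1) p by (auto simp: D_def powr_powr)
    have "Lp_norm M p f \<le> ennreal (D * r) * Lp_norm M p (grad_norm f)
        + ennreal (2 * r powr (- \<alpha>)) * Lp_norm M p (\<lambda>x. w x powr \<alpha> * \<bar>f x\<bar>)"
      if f: "f \<in> Lip" "is_median M f 0 \<or> (integrable M f \<and> (\<integral>x. f x \<partial>M) = 0)" and r: "0 < r" and \<alpha>: "0 < \<alpha>" for f r \<alpha>
      using f(2)
    proof
      assume "is_median M f 0"
      then show ?thesis
        using balanced_bound[OF f(1) balanced_if_median[OF True f(1)] r \<alpha> D(1,2)] by simp
    next
      assume "integrable M f \<and> (\<integral>x. f x \<partial>M) = 0"
      then show ?thesis
        using Lp_norm_interpolation_if_moment_le[OF p r D(1) c2(1) D(3) c2(2)[OF f(1) _ _ r \<alpha>]] by simp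
    qed
    with D(1) True show ?thesis by (intro exI[of _ D]) auto
  next
    case False
    then have inf: "emeasure M (space M) = \<infinity>" by (simp add: less_top[symmetric])
    define D where "D = (2 * c1) powr (1 / p)"
    have D: "0 < D" "2 * c1 \<le> D powr p" using c1 p by (auto simp: D_def powr_powr)
    have "f \<in> Lip" if "f \<in> Lip0" for f :: "'a \<Rightarrow> real" using that by (simp add: Lip0_def)
    with D False show ?thesis
      by (intro exI[of _ D]) (auto intro!: balanced_bound balanced_if_compact_support inf)
  qed
qed

end
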